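(* Let $X$ be a $\mathcal C$-valued random field, let $\nu=\nu_Z$ be the measure defined in the context from a stochastic representer $Z$, and let $\mu_u=\mu_u^{X,b}$ denote the normalised laws of $X$, $\mu_u(A)=a(u)\,\mathbb P\{u^{-1}\odot X\in A\}$ for Borel $A\subset\mathcal C_\Pi^\circ$. Then $X\in\mathrm{RV}_\Pi(\alpha,\nu;b)$ if and only if the following hold as $u\to\infty$: (i) for every $\boldsymbol h\in\mathsf D^q$, $$\mathbb I_{A_{\boldsymbol h}}\mu_u\Longrightarrow \mathbb I_{A_{\boldsymbol h}}\nu\quad\text{as finite measures on }\mathcal C;$$ (ii) when $\mathsf T=\mathbb R^m$, $$\limsup_{u\to\infty}\mu_u(O_n)\le\nu(O_n),\qquad n\ge1.$$ If $\mathsf T$ is discrete, then (i) implies the inequality in (ii) for every $n\ge 1$.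
   Context: Index set and paths. $q\in\mathbb N=\{1,2,\dots\}$; $\mathsf T$ is either a nonempty finite or countably infinite discrete set, or $\mathsf T=\mathbb R^m$ with $m\in\mathbb N$. $\mathcal C=C(\mathsf T,\mathbb R^q)$ is the space of continuous functions $f=(f_1,\dots,f_q)$ with the topology of locally uniform convergence and its Borel $\sigma$-field. $(K_n)_{n\ge1}$ is a fixed increasing exhaustion of $\mathsf T$ by nonempty compact sets such that every compact subset lies in some $K_n$; for $\mathsf T=\mathbb R^m$, $K_n=[-n,n]^m$. Put $\rho_{n,i}(f)=\sup_{t\in K_n}|f_i(t)|$. Scaling. $G=(0,\infty)^q$, $(r\odot f)(t)=(r_1f_1(t),\dots,r_qf_q(t))$ for $r\in G$, $u^{-1}=(u_1^{-1},\dots,u_q^{-1})$. Fix $\alpha\in(0,\infty)^q$ and put $\vartheta_\alpha(dr)=\prod_{i=1}^q\alpha_ir_i^{-\alpha_i-1}dr_i$ on $G$. Localisation. $\mathcal C_\Pi^\circ=\{f\in\mathcal C: f_i\not\equiv0\text{ for all }1\le i\le q\}$; $O_n=\{f\in\mathcal C:\min_{1\le i\le q}\rho_{n,i}(f)>1/n\}$. Product windows: $U_{\boldsymbol n,\varepsilon}=\{f\in\mathcal C:\rho_{n_i,i}(f)>\varepsilon_i,\ 1\le i\le q\}$, $\boldsymbol n\in\mathbb N^q$, $\varepsilon\in G$. A Borel measure on $\mathcal C_\Pi^\circ$ is boundedly finite if it is finite on every product window; measures on $\mathcal C_\Pi^\circ$ are identified with their zero extensions to $\mathcal C$. $C_\Pi(\mathcal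 C)$ is the set of bounded continuous $F:\mathcal C\to\mathbb R$ that vanish outside some product window. Target. $Z$ is a $\mathcal C_\Pi^\circ$-valued random element with $\mathbb E\{\prod_{i=1}^q\rho_{n_i,i}(Z)^{\alpha_i}\}<\infty$ for all $\boldsymbol n\in\mathbb N^q$, and $\nu=\nu_Z$, $\nu_Z(A)=\mathbb E\{\int_G\mathbb I_{\{r\odot Z\in A\}}\vartheta_\alpha(dr)\}$. Thresholds and rates. For $u\in G$, $u\to\infty$ means $\min_iu_i\to\infty$, with no restriction on relative rates (limits are along every such sequence); $\limsup_{u\to\infty}g(u)=\inf_{M>0}\sup_{u\in G,\min_iu_i\ge M}g(u)$. $b=(b_1,\dots,b_q)$ with $b_i:(0,\infty)\to(0,\infty)$ regularly varying at infinity with index $\alpha_i$; $a(u)=\prod_{i=1}^qb_i(u_i)$. $X\in\mathrm{RV}_\Pi(\alpha,\nu;b)$ means that $\nu$ is nonzero and boundedly finite and $\lim_{u\to\infty}\int F\,d\mu_u=\int F\,d\nu$ for every $F\in C_\Pi(\mathcal C)$. Anchors. $\mathsf D=\mathsf T$ if $\mathsf T$ is discrete and $\mathsf D=\mathbb Q^m$ if $\mathsf T=\mathbb R^m$. For $\boldsymbol h\in\mathsf T^q$, $A_{\boldsymbol h}=\{f\in\mathcal C:|f_i(h_i)|>1,\ 1\le i\le q\}$. $\mathbb I_A\mu$ is the restriction of $\mu$ to $A$. For finite measures, $\Longrightarrow$ means convergence of integrals of all bounded continuous functions (including total masses). *)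

theory Defs
  imports "HOL-Probability.Probability"
begin

section \<open>The space of continuous fields with locally uniform convergence\<close>

typedef (overloaded) ('t::topological_space, 'q::finite) cfun =
  "{f :: 't \<Rightarrow> real ^ 'q. continuous_on UNIV f}"
  morphisms apply_cfun Cfun
  by (auto intro: exI[of _ "\<lambda>_. 0"])

setup_lifting type_definition_cfun

text \<open>The topology is that of uniform convergence on compact sets, which is locally uniform
  convergence because the index spaces considered below are locally compact.  The type is kept
  distinct from the function type, whose own topology is that of pointwise convergence.\<close>

instantiation cfun :: (topological_space, finite) topological_space
begin

definition open_cfun :: "('a, 'b) cfun set \<Rightarrow> bool" where
  "open_cfun U \<longleftrightarrow>
     (\<forall>f\<in>U. \<exists>K e. compact K \<and> 0 < e \<and>
        {g. \<forall>t\<in>K. dist (apply_cfun g t) (apply_cfun f t) < e} \<subseteq> U)"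

instance
proof
  show "open (UNIV :: ('a, 'b) cfun set)"
    unfolding open_cfun_def by (auto intro!: exI[of _ "{}"] exI[of _ "1::real"])
next
  fix S T :: "('a, 'b) cfun set"
  assume S: "open S" and T: "open T"
  show "open (S \<inter> T)"
    unfolding open_cfun_def
  proof
    fix f assume "f \<in> S \<inter> T"
    then obtain K d L e where
      K: "compact K" "0 < d" "{g. \<forall>t\<in>K. dist (apply_cfun g t) (apply_cfun f t) < d} \<subseteq> S" and
      L: "compact L" "0 < e" "{g. \<forall>t\<in>L. dist (apply_cfun g t) (apply_cfun f t) < e} \<subseteq> T"
      using S T unfolding open_cfun_def by (meson IntE)
    have "compact (K \<union> L)" "0 < min d e"
      using K(1,2) L(1,2) by (auto intro: compact_Un)
    moreover have "{g. \<forall>t\<in>K \<union> L. dist (apply_cfun g t) (apply_cfun f t) < min d e} \<subseteq> S \<inter> T"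
      using K(3) L(3) by auto
    ultimately show "\<exists>K e. compact K \<and> 0 < e \<and>
        {g. \<forall>t\<in>K. dist (apply_cfun g t) (apply_cfun f t) < e} \<subseteq> S \<inter> T"
      by blast
  qed
next
  fix A :: "('a, 'b) cfun set set"
  assume "\<forall>S\<in>A. open S"
  then show "open (\<Union>A)"
    unfolding open_cfun_def by (meson Union_iff Union_upper order_trans)
qed

end

definition exhaustion :: "(nat \<Rightarrow> 't::topological_space set) \<Rightarrow> bool" where
  "exhaustion K \<longleftrightarrow>
     (\<forall>n\<ge>1. compact (K n) \<and> K n \<noteq> {} \<and> K n \<subseteq> K (Suc n)) \<and>
     (\<forall>C. compact C \<longrightarrow> (\<exists>n\<ge>1. C \<subseteq> K n))"

definition cube :: "nat \<Rightarrow> (real ^ 'm::finite) set" where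
  "cube n = {t. \<forall>j. t $ j \<in> {- real n .. real n}}"

definition rat_points :: "(real ^ 'm::finite) set" where
  "rat_points = {t. \<forall>j. t $ j \<in> \<rat>}"

definition rho ::
    "(nat \<Rightarrow> 't::topological_space set) \<Rightarrow> nat \<Rightarrow> 'q::finite \<Rightarrow> ('t, 'q) cfun \<Rightarrow> real" where
  "rho K n i f = (SUP t\<in>K n. \<bar>apply_cfun f t $ i\<bar>)"


section \<open>Scaling\<close>

definition pos_orthant :: "(real ^ 'q::finite) set" where
  "pos_orthant = {r. \<forall>i. 0 < r $ i}"

lift_definition scale_cfun ::
    "real ^ 'q::finite \<Rightarrow> ('t::topological_space, 'q) cfun \<Rightarrow> ('t, 'q) cfun"
  is "\<lambda>r f t. \<chi> i. r $ i * f t $ i"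
  by (intro continuous_intros)

definition vec_inverse :: "real ^ 'q::finite \<Rightarrow> real ^ 'q" where
  "vec_inverse u = (\<chi> i. inverse (u $ i))"

definition theta :: "real ^ 'q::finite \<Rightarrow> (real ^ 'q) measure" where
  "theta \<alpha> = density lborel
     (\<lambda>r. if r \<in> pos_orthant then ennreal (\<Prod>i\<in>UNIV. \<alpha> $ i * r $ i powr (- \<alpha> $ i - 1)) else 0)"


section \<open>Localisation\<close>

text \<open>Level indices range over the positive integers; \<open>K 0\<close> is never used.
  Measures on \<open>nonzero_fields\<close> are represented by their zero extensions, that is, by
  Borel measures on the whole of \<^typ>\<open>('t, 'q) cfun\<close>.\<close>

definition nonzero_fields :: "('t::topological_space, 'q::finite) cfun set" where
  "nonzero_fields = {f. \<forall>i. \<exists>t. apply_cfun f t $ i \<noteq> 0}"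

definition joint_set ::
    "(nat \<Rightarrow> 't::topological_space set) \<Rightarrow> nat \<Rightarrow> ('t, 'q::finite) cfun set" where
  "joint_set K n = {f. (MIN i. rho K n i f) > 1 / real n}"

definition window ::
    "(nat \<Rightarrow> 't::topological_space set) \<Rightarrow> ('q::finite \<Rightarrow> nat) \<Rightarrow> real ^ 'q \<Rightarrow> ('t, 'q) cfun set" where
  "window K n \<epsilon> = {f. \<forall>i. rho K (n i) i f > \<epsilon> $ i}"

definition boundedly_finite ::
    "(nat \<Rightarrow> 't::topological_space set) \<Rightarrow> ('t, 'q::finite) cfun measure \<Rightarrow> bool" where
  "boundedly_finite K \<nu> \<longleftrightarrow>
     (\<forall>n \<epsilon>. (\<forall>i. n i \<ge> 1) \<longrightarrow> \<epsilon> \<in> pos_orthant \<longrightarrow> emeasure \<nu> (window K n \<epsilon>) < \<infinity>)"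

definition test_functions ::
    "(nat \<Rightarrow> 't::topological_space set) \<Rightarrow> (('t, 'q::finite) cfun \<Rightarrow> real) set" where
  "test_functions K =
     {F. continuous_on UNIV F \<and> bounded (range F) \<and>
         (\<exists>n \<epsilon>. (\<forall>i. n i \<ge> 1) \<and> \<epsilon> \<in> pos_orthant \<and> (\<forall>f. f \<notin> window K n \<epsilon> \<longrightarrow> F f = 0))}"

definition restrict_measure :: "'a set \<Rightarrow> 'a measure \<Rightarrow> 'a measure" where
  "restrict_measure A \<mu> = density \<mu> (indicator A)"


section \<open>The target measure\<close>

definition representer ::
    "(nat \<Rightarrow> 't::topological_space set) \<Rightarrow> real ^ 'q::finite \<Rightarrow> 'v measure \<Rightarrow>
     ('v \<Rightarrow> ('t, 'q) cfun) \<Rightarrow> bool" where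
  "representer K \<alpha> N Z \<longleftrightarrow>
     Z \<in> borel_measurable N \<and> (\<forall>\<omega>\<in>space N. Z \<omega> \<in> nonzero_fields) \<and>
     (\<forall>n. (\<forall>i. n i \<ge> 1) \<longrightarrow>
        (\<integral>\<^sup>+\<omega>. ennreal (\<Prod>i\<in>UNIV. rho K (n i) i (Z \<omega>) powr (\<alpha> $ i)) \<partial>N) < \<infinity>)"

definition nu ::
    "real ^ 'q::finite \<Rightarrow> 'v measure \<Rightarrow> ('v \<Rightarrow> ('t::topological_space, 'q) cfun) \<Rightarrow>
     ('t, 'q) cfun measure" where
  "nu \<alpha> N Z = measure_of UNIV (sets borel)
     (\<lambda>A. \<integral>\<^sup>+\<omega>. (\<integral>\<^sup>+r. indicator A (scale_cfun r (Z \<omega>)) \<partial>theta \<alpha>) \<partial>N)"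


section \<open>Regular variation\<close>

text \<open>Measurability is part of the usual definition of a regularly varying function.\<close>

definition regularly_varying :: "(real \<Rightarrow> real) \<Rightarrow> real \<Rightarrow> bool" where
  "regularly_varying g \<kappa> \<longleftrightarrow>
     g \<in> borel_measurable (restrict_space borel {0<..}) \<and>
     (\<forall>x>0. g x > 0) \<and>
     (\<forall>c>0. ((\<lambda>x. g (c * x) / g x) \<longlongrightarrow> c powr \<kappa>) at_top)"

text \<open>The filter of \<open>u \<rightarrow> \<infinity>\<close>: all coordinates become large at unrestricted relative rates.
  The sets \<open>{u. (MIN i. u $ i) \<ge> M}\<close> with \<open>M > 0\<close> form a base and lie in the positive orthant.\<close>

definition thresholds_at_top :: "(real ^ 'q::finite) filter" where
  "thresholds_at_top = filtercomap (\<lambda>u. MIN i. u $ i) at_top"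

definition rate :: "('q::finite \<Rightarrow> real \<Rightarrow> real) \<Rightarrow> real ^ 'q \<Rightarrow> real" where
  "rate b u = (\<Prod>i\<in>UNIV. b i (u $ i))"

definition mu ::
    "('q::finite \<Rightarrow> real \<Rightarrow> real) \<Rightarrow> 'w measure \<Rightarrow> ('w \<Rightarrow> ('t::topological_space, 'q) cfun) \<Rightarrow>
     real ^ 'q \<Rightarrow> ('t, 'q) cfun measure" where
  "mu b M X u = restrict_measure nonzero_fields
     (scale_measure (ennreal (rate b u)) (distr M borel (\<lambda>\<omega>. scale_cfun (vec_inverse u) (X \<omega>))))"

text \<open>The index vector \<open>\<alpha>\<close> of \<open>RV\<^sub>\<Pi>(\<alpha>,\<nu>;b)\<close> enters through the regular variation of \<open>b\<close>.\<close>

definition RV_Pi ::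
    "(nat \<Rightarrow> 't::topological_space set) \<Rightarrow> real ^ 'q::finite \<Rightarrow> ('t, 'q) cfun measure \<Rightarrow>
     ('q \<Rightarrow> real \<Rightarrow> real) \<Rightarrow> 'w measure \<Rightarrow> ('w \<Rightarrow> ('t, 'q) cfun) \<Rightarrow> bool" where
  "RV_Pi K \<alpha> \<nu> b M X \<longleftrightarrow>
     (\<forall>i. regularly_varying (b i) (\<alpha> $ i)) \<and>
     emeasure \<nu> (space \<nu>) \<noteq> 0 \<and> boundedly_finite K \<nu> \<and>
     (\<forall>F\<in>test_functions K.
        ((\<lambda>u. \<integral>f. F f \<partial>mu b M X u) \<longlongrightarrow> (\<integral>f. F f \<partial>\<nu>)) thresholds_at_top)"


section \<open>Anchored convergence\<close>

definition weak_conv_finite ::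
    "('i \<Rightarrow> 'a::topological_space measure) \<Rightarrow> 'a measure \<Rightarrow> 'i filter \<Rightarrow> bool" where
  "weak_conv_finite \<mu> \<nu> F \<longleftrightarrow>
     finite_measure \<nu> \<and> (\<forall>\<^sub>F u in F. finite_measure (\<mu> u)) \<and>
     (\<forall>g :: 'a \<Rightarrow> real. continuous_on UNIV g \<longrightarrow> bounded (range g) \<longrightarrow>
        ((\<lambda>u. \<integral>x. g x \<partial>\<mu> u) \<longlongrightarrow> (\<integral>x. g x \<partial>\<nu>)) F)"

definition anchor_set :: "('q::finite \<Rightarrow> 't::topological_space) \<Rightarrow> ('t, 'q) cfun set" where
  "anchor_set h = {f. \<forall>i. \<bar>apply_cfun f (h i) $ i\<bar> > 1}"

definition anchor_convergence ::
    "'t::topological_space set \<Rightarrow> (real ^ 'q::finite \<Rightarrow> ('t, 'q) cfun measure) \<Rightarrow>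
     ('t, 'q) cfun measure \<Rightarrow> bool" where
  "anchor_convergence D \<mu> \<nu> \<longleftrightarrow>
     (\<forall>h. (\<forall>i. h i \<in> D) \<longrightarrow>
        weak_conv_finite (\<lambda>u. restrict_measure (anchor_set h) (\<mu> u))
          (restrict_measure (anchor_set h) \<nu>) thresholds_at_top)"

end

theory Submission
  imports Defs
begin

text \<open>The anchored sets and the joint windows are superlevel sets of two continuous positively
  homogeneous functionals, \<open>anchor_level\<close> and \<open>joint_level\<close>. Since \<open>\<nu>\<close> is homogeneous,
  \<open>c \<mapsto> \<nu> {f. c < q f}\<close> is a power of \<open>c\<close> for such a functional \<open>q\<close>, so restricting to a superlevel
  set preserves convergence; this gives the forward direction. Conversely, regular variation of
  the rates transfers the two conditions from level one to every level. A window is a countable union of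
  anchored sets, and the continuous functions \<open>1 - (\<Prod>j<k. 1 - \<phi> j)\<close>, with \<open>\<phi> j\<close> supported in the
  \<open>j\<close>-th anchored set, increase to its indicator. Integrals against them converge by the anchored
  condition, and the bound on the limit superior of the window masses controls the remainder. Over a
  discrete index set the union is finite, and the same functions, taken at a slightly lower level,
  yield that bound.\<close>

section \<open>Ramps and nets of finite Borel measures\<close>

text \<open>The anchored condition sees only finitely many evaluation points at a time, so mass of
  \<open>\<mu> u\<close> could slip between the anchors: a field with tall thin peaks may lie in a
  window and still avoid every anchor considered so far. The second condition excludes this. Only an
  upper bound is asked, since the glued functions lie below the indicator of the window while their
  \<nu>-integrals approach its \<nu>-mass, so the matching lower bound already follows from the
  anchors. The masses of \<open>\<mu> u\<close> may grow without bound and \<nu> need not be finite,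
  so all limits are confined to open sets of finite \<nu>-mass. The field space enters as a bare
  topological space: indicators are approximated by ramps of one continuous functional, and the
  usual condition of a null boundary becomes continuity of \<nu>-mass in the level. A change of
  level by c is a change of threshold from u to c u. It costs the factor c to the power of minus the
  sum of the \<alpha> i, once through the limit of the rate ratio and once through the homogeneity
  of \<nu>; that the two factors agree is what makes the transfer possible.\<close>

definition ramp :: "real \<Rightarrow> real \<Rightarrow> real \<Rightarrow> real" where
  "ramp a b x = max 0 (min 1 ((x - a) / (b - a)))"

lemma ramp_bounds: "0 \<le> ramp a b x" "ramp a b x \<le> 1"
  by (auto simp: ramp_def)

lemma ramp_eq_0: "a < b \<Longrightarrow> x \<le> a \<Longrightarrow> ramp a b x = 0"
  by (auto simp: ramp_def divide_nonpos_pos)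

lemma ramp_eq_1: "a < b \<Longrightarrow> b \<le> x \<Longrightarrow> ramp a b x = 1"
  by (auto simp: ramp_def)

lemma continuous_on_ramp:
  assumes "a < b" "continuous_on S f"
  shows "continuous_on S (\<lambda>x. ramp a b (f x))"
  unfolding ramp_def using assms by (intro continuous_intros) auto

definition bdd_continuous :: "('a::topological_space \<Rightarrow> real) \<Rightarrow> bool" where
  "bdd_continuous g \<longleftrightarrow> continuous_on UNIV g \<and> bounded (range g)"

lemma bdd_continuousI:
  assumes "continuous_on UNIV g" "\<And>x. \<bar>g x\<bar> \<le> B"
  shows "bdd_continuous g"
  using assms by (auto simp: bdd_continuous_def bounded_iff)

lemma bdd_continuousE:
  assumes "bdd_continuous g"
  obtains B where "0 \<le> B" "\<And>x. \<bar>g x\<bar> \<le> B"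
proof -
  obtain B where B: "\<And>x. \<bar>g x\<bar> \<le> B"
    using assms by (auto simp: bdd_continuous_def bounded_iff)
  have "0 \<le> B"
    using B[of undefined] by linarith
  with B that show ?thesis
    by blast
qed

lemma abs_mult_le_bound:
  fixes x y B :: real
  assumes "\<bar>x\<bar> \<le> B" "0 \<le> y" "y \<le> 1"
  shows "\<bar>x * y\<bar> \<le> B"
proof -
  have "\<bar>x * y\<bar> \<le> \<bar>x\<bar> * 1"
    unfolding abs_mult using assms by (intro mult_left_mono) auto
  with assms show ?thesis
    by simp
qed

lemma bdd_continuous_mult:
  assumes f: "bdd_continuous f" and g: "bdd_continuous g"
  shows "bdd_continuous (\<lambda>x. f x * g x)"
proof -
  obtain B C where "0 \<le> B" "\<And>x. \<bar>f x\<bar> \<le> B" "\<And>x. \<bar>g x\<bar> \<le> C"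
    using f g by (meson bdd_continuousE)
  then have "\<bar>f x * g x\<bar> \<le> B * C" for x
    by (simp add: abs_mult mult_mono)
  moreover have "continuous_on UNIV (\<lambda>x. f x * g x)"
    using f g by (auto simp: bdd_continuous_def intro!: continuous_intros)
  ultimately show ?thesis
    by (rule bdd_continuousI[rotated])
qed

lemma bdd_continuous_ramp:
  "a < b \<Longrightarrow> continuous_on UNIV q \<Longrightarrow> bdd_continuous (\<lambda>x. ramp a b (q x))"
  by (rule bdd_continuousI[where B = 1]) (auto simp: ramp_bounds abs_le_iff intro: continuous_on_ramp
      order_trans[OF _ ramp_bounds(1)] )

lemma open_superlevel:
  fixes q :: "'a::topological_space \<Rightarrow> real"
  assumes "continuous_on UNIV q"
  shows "open {x. c < q x}"
  using open_Collect_less[of "\<lambda>_. c" q] assms by simp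

lemma borel_measurable_indicator_open:
  "open A \<Longrightarrow> (indicator A :: _ \<Rightarrow> real) \<in> borel_measurable borel"
  by (intro borel_measurable_indicator borel_open)

section \<open>Gluing and portmanteau arguments along a filter\<close>

locale borel_measure_net =
  fixes \<mu> :: "'i \<Rightarrow> 'a::topological_space measure" and \<nu> :: "'a measure" and F :: "'i filter"
  assumes finite_net: "\<And>u. finite_measure (\<mu> u)"
    and sets_net: "\<And>u. sets (\<mu> u) = sets borel"
    and sets_limit: "sets \<nu> = sets borel"
begin

definition conv :: "('a \<Rightarrow> real) \<Rightarrow> bool" where
  "conv g \<longleftrightarrow> ((\<lambda>u. \<integral>x. g x \<partial>\<mu> u) \<longlongrightarrow> (\<integral>x. g x \<partial>\<nu>)) F"

text \<open>This encodes weak convergence of the restrictions to \<open>A\<close>, total masses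
  included (take \<open>g\<close> constantly 1), without forming the restricted measures.\<close>

definition conv_on :: "'a set \<Rightarrow> bool" where
  "conv_on A \<longleftrightarrow> (\<forall>g. bdd_continuous g \<longrightarrow> conv (\<lambda>x. g x * indicator A x))"

lemma open_in_sets: "open A \<Longrightarrow> A \<in> sets (\<mu> u)" "open A \<Longrightarrow> A \<in> sets \<nu>"
  by (simp_all add: sets_net sets_limit)

lemma measurable_net:
  "g \<in> borel_measurable borel \<Longrightarrow> g \<in> borel_measurable (\<mu> u)"
  "g \<in> borel_measurable borel \<Longrightarrow> g \<in> borel_measurable \<nu>"
  by (simp_all cong: measurable_cong_sets add: sets_net sets_limit)

lemma integrable_net:
  fixes g :: "'a \<Rightarrow> real"
  assumes "g \<in> borel_measurable borel" "\<And>x. \<bar>g x\<bar> \<le> B"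
  shows "integrable (\<mu> u) g"
  using assms by (intro finite_measure.integrable_const_bound[OF finite_net, where B = B])
    (auto simp: measurable_net)

lemma integrable_limit:
  fixes g :: "'a \<Rightarrow> real"
  assumes "g \<in> borel_measurable borel" "\<And>x. \<bar>g x\<bar> \<le> B"
    and "open S" "emeasure \<nu> S < \<infinity>" "\<And>x. x \<notin> S \<Longrightarrow> g x = 0"
  shows "integrable \<nu> g"
  using assms by (intro integrableI_bounded_set[where A = S and B = B]) (auto simp: measurable_net open_in_sets)

lemma conv_add:
  assumes f: "f \<in> borel_measurable borel" "\<And>x. \<bar>f x\<bar> \<le> B"
    and g: "g \<in> borel_measurable borel" "\<And>x. \<bar>g x\<bar> \<le> C"
    and S: "open S" "emeasure \<nu> S < \<infinity>" "\<And>x. x \<notin> S \<Longrightarrow> f x = 0" "\<And>x. x \<notin> S \<Longrightarrow> g x = 0"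
    and "conv f" "conv g"
  shows "conv (\<lambda>x. f x + g x)"
  using assms
  by (simp add: conv_def integrable_net[OF f] integrable_net[OF g]
        integrable_limit[OF f S(1-3)] integrable_limit[OF g S(1,2,4)] tendsto_add)

text \<open>The union of finitely many anchored pieces is glued by
  \<open>1 - (\<Prod>j\<in>J. 1 - \<phi> j) = (\<Sum>j\<in>J. \<phi> j * \<dots>)\<close>: no boundary of a piece has to be negligible.\<close>

lemma conv_glue:
  assumes "finite J"
    and "\<And>j. j \<in> J \<Longrightarrow> conv_on (A j)" "\<And>j. j \<in> J \<Longrightarrow> open (A j)"
    and "\<And>j. j \<in> J \<Longrightarrow> emeasure \<nu> (A j) < \<infinity>"
    and "\<And>j. j \<in> J \<Longrightarrow> continuous_on UNIV (\<phi> j)"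
    and "\<And>j x. j \<in> J \<Longrightarrow> 0 \<le> \<phi> j x \<and> \<phi> j x \<le> 1"
    and "\<And>j x. j \<in> J \<Longrightarrow> x \<notin> A j \<Longrightarrow> \<phi> j x = 0"
    and "bdd_continuous g"
  shows "conv (\<lambda>x. g x * (1 - (\<Prod>j\<in>J. 1 - \<phi> j x)))"
  using assms
proof (induction J)
  case empty
  then show ?case
    by (simp add: conv_def)
next
  case (insert j J)
  obtain B where B: "0 \<le> B" "\<And>x. \<bar>g x\<bar> \<le> B"
    using insert.prems by (meson bdd_continuousE)
  have [simp]: "continuous_on UNIV g"
    using insert.prems by (simp add: bdd_continuous_def)
  let ?P = "\<lambda>x. \<Prod>k\<in>J. 1 - \<phi> k x"
  \<comment> \<open>Inserting \<open>j\<close> multiplies the product by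
    \<open>1 - \<phi> j x\<close>, so the new function is exactly \<open>?f + ?h\<close>. The
    induction hypothesis handles \<open>?f\<close>; \<open>?h\<close> carries the factor
    \<open>\<phi> j\<close>, so the indicator of \<open>A j\<close> may be attached to it for
    free.\<close>
  let ?f = "\<lambda>x. g x * (1 - ?P x)" and ?h = "\<lambda>x. g x * \<phi> j x * ?P x"
  have P: "0 \<le> ?P x" "?P x \<le> 1" for x
    using insert.prems(5) by (auto intro!: prod_nonneg prod_le_1)
  have \<phi>: "0 \<le> \<phi> j x" "\<phi> j x \<le> 1" for x
    using insert.prems(5) by auto
  have cont: "continuous_on UNIV ?f" "continuous_on UNIV ?h"
    using insert.prems(4) by (auto intro!: continuous_intros)
  have bnd: "\<bar>?f x\<bar> \<le> B" "\<bar>?h x\<bar> \<le> B" for x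
    using P[of x] \<phi>[of x] B by (auto intro!: abs_mult_le_bound)
  let ?S = "A j \<union> (\<Union>k\<in>J. A k)"
  have S: "open ?S"
    using insert.prems(2) by auto
  have "emeasure \<nu> ?S \<le> emeasure \<nu> (A j) + emeasure \<nu> (\<Union>k\<in>J. A k)"
    using insert.prems(2) by (intro emeasure_subadditive open_in_sets) auto
  also have "\<dots> \<le> emeasure \<nu> (A j) + (\<Sum>k\<in>J. emeasure \<nu> (A k))"
    using insert.prems(2) insert.hyps
    by (intro add_left_mono emeasure_subadditive_finite) (auto intro: open_in_sets)
  also have "\<dots> < \<infinity>"
    using insert.prems(3) insert.hyps by (auto simp: less_top)
  finally have fin: "emeasure \<nu> ?S < \<infinity>" .
  have "conv ?f"
    using insert.prems by (intro insert.IH) auto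
  moreover have "conv ?h"
  proof -
    have eq: "(\<lambda>x. ?h x * indicator (A j) x) = ?h"
      using insert.prems(6)[of j] by (auto split: split_indicator)
    have "bdd_continuous ?h"
      using bnd(2) cont(2) by (intro bdd_continuousI[where B = B]) auto
    then have "conv (\<lambda>x. ?h x * indicator (A j) x)"
      using insert.prems(1)[of j] unfolding conv_on_def by blast
    then show ?thesis
      by (simp only: eq)
  qed
  moreover have "?f x = 0" if "x \<notin> ?S" for x
    using that insert.prems(6) by simp
  moreover have "?h x = 0" if "x \<notin> ?S" for x
    using that insert.prems(6) by simp
  ultimately have "conv (\<lambda>x. ?f x + ?h x)"
    using cont bnd S fin
    by (intro conv_add[where S = ?S and B = B and C = "B"])
      (auto intro: borel_measurable_continuous_onI)
  moreover have "(\<lambda>x. ?f x + ?h x) = (\<lambda>x. g x * (1 - (\<Prod>k\<in>insert j J. 1 - \<phi> k x)))"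
    using insert.hyps by (auto simp: algebra_simps)
  ultimately show ?case
    by simp
qed

lemma measure_net_mono:
  fixes g :: "'a \<Rightarrow> real"
  assumes "g \<in> borel_measurable borel" "\<And>x. \<bar>g x\<bar> \<le> 1" "open S" "\<And>x. indicator S x \<le> g x"
  shows "measure (\<mu> u) S \<le> (\<integral>x. g x \<partial>\<mu> u)"
proof -
  interpret finite_measure "\<mu> u" by (rule finite_net)
  have "measure (\<mu> u) S = (\<integral>x. indicator S x \<partial>\<mu> u)"
    by (simp add: open_in_sets assms)
  also have "\<dots> \<le> (\<integral>x. g x \<partial>\<mu> u)"
    using assms by (intro integral_mono integrable_net[where B = 1] ) (auto simp: borel_measurable_indicator_open split: split_indicator)
  finally show ?thesis .
qed

lemma integral_limit_le:
  fixes g :: "'a \<Rightarrow> real"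
  assumes "g \<in> borel_measurable borel" "\<And>x. \<bar>g x\<bar> \<le> 1" "open S" "emeasure \<nu> S < \<infinity>"
    "\<And>x. g x \<le> indicator S x" "\<And>x. x \<notin> S \<Longrightarrow> g x = 0"
  shows "(\<integral>x. g x \<partial>\<nu>) \<le> measure \<nu> S"
proof -
  have "(\<integral>x. g x \<partial>\<nu>) \<le> (\<integral>x. indicator S x \<partial>\<nu>)"
    using assms
    by (intro integral_mono integrable_limit[where B = 1 and S = S]) (auto simp: borel_measurable_indicator_open split: split_indicator)
  also have "\<dots> = measure \<nu> S"
    by (simp add: open_in_sets assms)
  finally show ?thesis .
qed

text \<open>A continuous function is squeezed between the indicators of the levels \<open>c\<close>
  and \<open>d < c\<close> of \<open>w\<close>: glued ramps of the finitely many \<open>q j\<close>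
  equal 1 above \<open>c\<close> and vanish below \<open>d\<close>. Its integrals converge, dominate
  the masses at level \<open>c\<close> along the net, and in the limit stay below the \<nu>-mass at
  level \<open>d\<close>.\<close>

lemma finite_cover_limsup:
  fixes q :: "'j \<Rightarrow> 'a \<Rightarrow> real" and w :: "'a \<Rightarrow> real" and c e :: real
  assumes J: "finite J"
    and q: "\<And>j. j \<in> J \<Longrightarrow> continuous_on UNIV (q j)"
    and w: "continuous_on UNIV w"
    and cover: "\<And>c. 0 < c \<Longrightarrow> {x. c < w x} = (\<Union>j\<in>J. {x. c < q j x})"
    and fin: "\<And>c. 0 < c \<Longrightarrow> emeasure \<nu> {x. c < w x} < \<infinity>"
    and conv: "\<And>c j. 0 < c \<Longrightarrow> j \<in> J \<Longrightarrow> conv_on {x. c < q j x}"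
    and c: "0 < c" "isCont (\<lambda>c. measure \<nu> {x. c < w x}) c" and e: "0 < e"
  shows "\<forall>\<^sub>F u in F. measure (\<mu> u) {x. c < w x} < measure \<nu> {x. c < w x} + e"
proof -
  let ?m = "\<lambda>c. measure \<nu> {x. c < w x}"
  \<comment> \<open>Left continuity of the mass in the level makes the loss from \<open>c\<close> to
    \<open>d\<close> smaller than \<open>e\<close>.\<close>
  have "\<exists>d>0. d < c \<and> ?m d < ?m c + e"
  proof -
    have "(?m \<longlongrightarrow> ?m c) (at_left c)"
      using c(2) by (auto simp: isCont_def intro: tendsto_within_subset)
    then have "\<forall>\<^sub>F d in at_left c. ?m d < ?m c + e"
      using e by (intro order_tendstoD(2)) auto
    moreover have "\<forall>\<^sub>F d in at_left c. d \<in> {0<..<c}"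
      using c by (intro eventually_at_left_real)
    ultimately have "\<forall>\<^sub>F d in at_left c. d \<in> {0<..<c} \<and> ?m d < ?m c + e"
      by eventually_elim auto
    then show ?thesis
      using eventually_happens[of _ "at_left c"] by (auto simp: trivial_limit_at_left_real)
  qed
  then obtain d where d: "0 < d" "d < c" "?m d < ?m c + e"
    by auto
  let ?\<psi> = "\<lambda>x. 1 - (\<Prod>j\<in>J. 1 - ramp d c (q j x))"
  have sub: "{x. d < q j x} \<subseteq> {x. d < w x}" if "j \<in> J" for j
    using cover[OF d(1)] that by auto
  have "conv (\<lambda>x. 1 * ?\<psi> x)"
  proof (rule conv_glue[where A = "\<lambda>j. {x. d < q j x}"])
    fix j assume "j \<in> J"
    have "emeasure \<nu> {x. d < q j x} \<le> emeasure \<nu> {x. d < w x}"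
      using sub \<open>j \<in> J\<close> w by (intro emeasure_mono open_in_sets open_superlevel) auto
    then show "emeasure \<nu> {x. d < q j x} < \<infinity>"
      using fin[OF d(1)] by (rule le_less_trans)
  qed (use J q d conv in \<open>auto simp: open_superlevel ramp_bounds ramp_eq_0 bdd_continuous_def
        intro!: continuous_on_ramp\<close>)
  then have conv_\<psi>: "((\<lambda>u. \<integral>x. ?\<psi> x \<partial>\<mu> u) \<longlongrightarrow> (\<integral>x. ?\<psi> x \<partial>\<nu>)) F"
    by (simp add: conv_def)
  have \<psi>: "0 \<le> ?\<psi> x" "?\<psi> x \<le> 1" for x
    by (auto simp: ramp_bounds intro!: prod_nonneg prod_le_1)
  have meas: "?\<psi> \<in> borel_measurable borel"
    using q d by (intro borel_measurable_continuous_onI continuous_intros continuous_on_ramp) auto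
  have vanish: "?\<psi> x = 0" if "x \<notin> {x. d < w x}" for x
  proof -
    have "ramp d c (q j x) = 0" if "j \<in> J" for j
      using sub[OF that] \<open>x \<notin> {x. d < w x}\<close> d by (intro ramp_eq_0) (auto simp: not_less[symmetric])
    then show ?thesis
      by simp
  qed
  have "(\<integral>x. ?\<psi> x \<partial>\<nu>) \<le> ?m d"
    using \<psi> meas w d fin vanish
    by (intro integral_limit_le open_superlevel) (auto simp: borel_measurable_indicator_open abs_le_iff split: split_indicator)
  then have "\<forall>\<^sub>F u in F. (\<integral>x. ?\<psi> x \<partial>\<mu> u) < ?m c + e"
    using order_tendstoD(2)[OF conv_\<psi>, of "?m c + e"] d(3) by linarith
  then show ?thesis
  proof eventually_elim
    case (elim u)
    have "?\<psi> x = 1" if "c < w x" for x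
    proof -
      from that have "x \<in> (\<Union>j\<in>J. {x. c < q j x})"
        using cover[OF c(1)] by (metis mem_Collect_eq)
      then obtain j where "j \<in> J" "c < q j x"
        by blast
      then have "1 - ramp d c (q j x) = 0"
        using d by (simp add: ramp_eq_1)
      with \<open>j \<in> J\<close> J show ?thesis
        by (auto simp: prod_zero_iff)
    qed
    then have "measure (\<mu> u) {x. c < w x} \<le> (\<integral>x. ?\<psi> x \<partial>\<mu> u)"
      using \<psi> meas w by (intro measure_net_mono open_superlevel) (auto simp: borel_measurable_indicator_open abs_le_iff split: split_indicator)
    with elim show ?case
      by linarith
  qed
qed

text \<open>Since \<open>g\<close> vanishes off \<open>W\<close>, replacing \<open>g\<close> by
  \<open>g x * \<psi> k x\<close> costs at most a multiple of the mass of \<open>W\<close> that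
  \<open>\<psi> k\<close> misses. For \<nu> this is small once \<open>k\<close> is large. For the
  net it is small too, as \<open>upper\<close> bounds the mass of \<open>W\<close> from above while
  the integral of \<open>\<psi> k\<close> converges.\<close>

lemma conv_of_anchors:
  fixes q :: "nat \<Rightarrow> 'a \<Rightarrow> real" and c :: real
  assumes q: "\<And>j. continuous_on UNIV (q j)" and W: "W = (\<Union>j. {x. c < q j x})"
    and fin: "emeasure \<nu> W < \<infinity>"
    and conv: "\<And>j. conv_on {x. c < q j x}"
    and upper: "\<And>e. 0 < e \<Longrightarrow> \<forall>\<^sub>F u in F. measure (\<mu> u) W < measure \<nu> W + e"
    and g: "bdd_continuous g" "\<And>x. x \<notin> W \<Longrightarrow> g x = 0"
  shows "conv g"
proof -
  \<comment> \<open>One index \<open>k\<close> drives both the number of anchored pieces and the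
    steepness of the ramps. At a point of \<open>W\<close> some \<open>q j\<close> exceeds
    \<open>c\<close>; as soon as \<open>j < k\<close> and \<open>c + 1 / Suc k\<close> is below that
    value, one factor of the product is 0 and \<open>\<psi> k\<close> equals 1.\<close>
  define \<phi> where "\<phi> k j x = ramp c (c + 1 / Suc k) (q j x)" for k j x
  define \<psi> where "\<psi> k x = 1 - (\<Prod>j<k. 1 - \<phi> k j x)" for k x
  have [simp]: "open W"
    unfolding W by (intro open_UN ballI open_superlevel q)
  have \<phi>: "0 \<le> \<phi> k j x" "\<phi> k j x \<le> 1" for k j x
    by (auto simp: \<phi>_def ramp_bounds)
  have cont_\<phi>: "continuous_on UNIV (\<phi> k j)" for k j
    unfolding \<phi>_def using q by (intro continuous_on_ramp) auto
  have \<psi>: "0 \<le> \<psi> k x" "\<psi> k x \<le> 1" for k x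
    unfolding \<psi>_def using \<phi> by (auto intro!: prod_nonneg prod_le_1)
  have cont_\<psi>: "continuous_on UNIV (\<psi> k)" for k
    unfolding \<psi>_def using cont_\<phi> by (intro continuous_intros) auto
  then have meas_\<psi>: "\<psi> k \<in> borel_measurable borel" for k
    by (rule borel_measurable_continuous_onI)
  have \<psi>_out: "\<psi> k x = 0" if "x \<notin> W" for k x
    using that unfolding \<psi>_def \<phi>_def W by (auto intro!: prod.neutral ramp_eq_0 simp: not_less)
  have glue: "conv (\<lambda>x. h x * \<psi> k x)" if h: "bdd_continuous h" for h k
    unfolding \<psi>_def
  proof (rule conv_glue[where A = "\<lambda>j. {x. c < q j x}"])
    fix j
    have "emeasure \<nu> {x. c < q j x} \<le> emeasure \<nu> W"
      by (intro emeasure_mono open_in_sets \<open>open W\<close>) (auto simp: W)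
    then show "emeasure \<nu> {x. c < q j x} < \<infinity>"
      using fin by (rule le_less_trans)
  qed (use q conv h cont_\<phi> \<phi> in \<open>auto simp: open_superlevel \<phi>_def ramp_eq_0\<close>)
  have lim: "(\<lambda>k. \<psi> k x) \<longlonglongrightarrow> indicator W x" for x
  proof (cases "x \<in> W")
    case True
    then obtain j where j: "c < q j x"
      by (auto simp: W)
    have "(\<lambda>k. c + 1 / Suc k) \<longlonglongrightarrow> c + 0"
      by (intro tendsto_intros LIMSEQ_Suc[OF lim_1_over_n])
    then have "\<forall>\<^sub>F k in sequentially. c + 1 / Suc k < q j x"
      using j by (intro order_tendstoD(2)) auto
    moreover have "\<forall>\<^sub>F k in sequentially. j < k"
      by (rule eventually_gt_at_top)
    ultimately have "\<forall>\<^sub>F k in sequentially. \<psi> k x = 1"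
    proof eventually_elim
      case (elim k)
      then have "\<phi> k j x = 1"
        unfolding \<phi>_def by (intro ramp_eq_1) auto
      with elim show ?case
        unfolding \<psi>_def by (auto intro!: bexI[of _ j])
    qed
    with True show ?thesis
      by (simp add: tendsto_eventually)
  qed (simp add: \<psi>_out)
  \<comment> \<open>Dominated convergence is applied in the sequence index \<open>k\<close> under
    the fixed measure \<nu> only; the limit along \<open>F\<close> is taken afterwards with
    \<open>k\<close> frozen.\<close>
  have int_lim: "(\<lambda>k. \<integral>x. \<psi> k x \<partial>\<nu>) \<longlonglongrightarrow> measure \<nu> W"
  proof -
    have "(\<lambda>k. \<integral>x. \<psi> k x \<partial>\<nu>) \<longlonglongrightarrow> (\<integral>x. indicator W x \<partial>\<nu>)"
    proof (rule integral_dominated_convergence)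
      show "integrable \<nu> (indicator W :: 'a \<Rightarrow> real)"
        using fin by (intro integrable_limit[where B = 1 and S = W]) (auto simp: borel_measurable_indicator_open)
      show "AE x in \<nu>. norm (\<psi> k x) \<le> indicator W x" for k
        using \<psi> \<psi>_out by (auto simp: borel_measurable_indicator_open split: split_indicator)
    qed (auto simp: open_in_sets meas_\<psi> measurable_net lim)
    then show ?thesis
      by (simp add: open_in_sets)
  qed
  obtain B where B: "0 \<le> B" "\<And>x. \<bar>g x\<bar> \<le> B"
    using g(1) by (meson bdd_continuousE)
  have meas_g: "g \<in> borel_measurable borel"
    using g(1) by (auto simp: bdd_continuous_def intro: borel_measurable_continuous_onI)
  have g\<psi>_bound: "\<bar>g x * \<psi> k x\<bar> \<le> B" for x k
    using \<psi> B by (intro abs_mult_le_bound) auto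
  have \<psi>_abs: "\<bar>\<psi> k x\<bar> \<le> 1" for x k
    using \<psi>[of k x] by simp
  have one: "bdd_continuous (\<lambda>_::'a. 1)"
    by (auto simp: bdd_continuous_def)
  \<comment> \<open>This pointwise bound is integrated twice, against \<open>\<mu> u\<close> and
    against \<nu>.\<close>
  have gW: "\<bar>g x - g x * \<psi> k x\<bar> \<le> B * (indicator W x - \<psi> k x)" for k x
  proof (cases "x \<in> W")
    case True
    have "\<bar>g x - g x * \<psi> k x\<bar> = \<bar>g x\<bar> * \<bar>1 - \<psi> k x\<bar>"
      by (simp add: algebra_simps flip: abs_mult)
    also have "\<dots> \<le> B * (1 - \<psi> k x)"
      using B \<psi>[of k x] by (intro mult_mono) auto
    finally show ?thesis
      using True by simp
  qed (simp add: g \<psi>_out)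
  have diff_net: "\<bar>(\<integral>x. g x \<partial>\<mu> u) - (\<integral>x. g x * \<psi> k x \<partial>\<mu> u)\<bar>
      \<le> B * (measure (\<mu> u) W - (\<integral>x. \<psi> k x \<partial>\<mu> u))" for u k
  proof -
    have i: "integrable (\<mu> u) g" "integrable (\<mu> u) (\<lambda>x. g x * \<psi> k x)" "integrable (\<mu> u) (\<psi> k)"
      "integrable (\<mu> u) (indicator W :: 'a \<Rightarrow> real)"
      by (rule integrable_net[OF _ B(2)] integrable_net[OF _ g\<psi>_bound]
          integrable_net[OF _ \<psi>_abs] integrable_net[where B = 1];
          use meas_g meas_\<psi> in \<open>auto simp: borel_measurable_indicator_open intro!: borel_measurable_times\<close>)+
    have "\<bar>\<integral>x. g x - g x * \<psi> k x \<partial>\<mu> u\<bar> \<le> (\<integral>x. \<bar>g x - g x * \<psi> k x\<bar> \<partial>\<mu> u)"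
      by (rule integral_abs_bound)
    also have "\<dots> \<le> (\<integral>x. B * (indicator W x - \<psi> k x) \<partial>\<mu> u)"
      using i gW by (intro integral_mono) auto
    also have "\<dots> = B * (measure (\<mu> u) W - (\<integral>x. \<psi> k x \<partial>\<mu> u))"
      using i by (simp add: open_in_sets)
    finally show ?thesis
      using i by simp
  qed
  have diff_limit: "\<bar>(\<integral>x. g x \<partial>\<nu>) - (\<integral>x. g x * \<psi> k x \<partial>\<nu>)\<bar>
      \<le> B * (measure \<nu> W - (\<integral>x. \<psi> k x \<partial>\<nu>))" for k
  proof -
    have i: "integrable \<nu> g" "integrable \<nu> (\<lambda>x. g x * \<psi> k x)" "integrable \<nu> (\<psi> k)"
      "integrable \<nu> (indicator W :: 'a \<Rightarrow> real)"
      by (rule integrable_limit[OF _ B(2) \<open>open W\<close> fin] integrable_limit[OF _ g\<psi>_bound \<open>open W\<close> fin]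
          integrable_limit[OF _ \<psi>_abs \<open>open W\<close> fin] integrable_limit[OF _ _ \<open>open W\<close> fin, where B = 1];
          use meas_g meas_\<psi> g(2) \<psi>_out in
            \<open>auto simp: borel_measurable_indicator_open intro!: borel_measurable_times\<close>)+
    have "\<bar>\<integral>x. g x - g x * \<psi> k x \<partial>\<nu>\<bar> \<le> (\<integral>x. \<bar>g x - g x * \<psi> k x\<bar> \<partial>\<nu>)"
      by (rule integral_abs_bound)
    also have "\<dots> \<le> (\<integral>x. B * (indicator W x - \<psi> k x) \<partial>\<nu>)"
      using i gW by (intro integral_mono) auto
    also have "\<dots> = B * (measure \<nu> W - (\<integral>x. \<psi> k x \<partial>\<nu>))"
      using i by (simp add: open_in_sets)
    finally show ?thesis
      using i by simp
  qed
  show ?thesis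
    unfolding conv_def
  proof (rule tendstoI)
    fix e :: real assume e: "0 < e"
    \<comment> \<open>\<open>B + 1\<close> guards against \<open>B = 0\<close>. The error budget is
      \<open>2 * B * d \<le> e / 2\<close> for the net, \<open>B * d \<le> e / 4\<close> for the
      limit, and less than \<open>e / 4\<close> for the glued integrals.\<close>
    define d where "d = e / (4 * (B + 1))"
    have d: "0 < d" "B * d \<le> e / 4"
      using e B by (auto simp: d_def field_simps)
    have "\<forall>\<^sub>F k in sequentially. measure \<nu> W - d < (\<integral>x. \<psi> k x \<partial>\<nu>)"
      using d by (intro order_tendstoD(1)[OF int_lim]) auto
    then obtain k where k: "measure \<nu> W - d < (\<integral>x. \<psi> k x \<partial>\<nu>)"
      by (auto simp: eventually_sequentially)
    have lim1: "\<forall>\<^sub>F u in F. dist (\<integral>x. g x * \<psi> k x \<partial>\<mu> u) (\<integral>x. g x * \<psi> k x \<partial>\<nu>) < e / 4"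
      using e by (intro tendstoD[OF glue[OF g(1), of k, unfolded conv_def]]) simp
    have lim2: "\<forall>\<^sub>F u in F. measure \<nu> W - d < (\<integral>x. \<psi> k x \<partial>\<mu> u)"
      using order_tendstoD(1)[OF glue[OF one, of k, unfolded conv_def] ] k by simp
    show "\<forall>\<^sub>F u in F. dist (\<integral>x. g x \<partial>\<mu> u) (\<integral>x. g x \<partial>\<nu>) < e"
      using lim1 lim2 upper[OF d(1)]
    proof eventually_elim
      case (elim u)
      have "B * (measure (\<mu> u) W - (\<integral>x. \<psi> k x \<partial>\<mu> u)) \<le> B * (2 * d)"
        using elim B by (intro mult_left_mono) auto
      moreover have "B * (measure \<nu> W - (\<integral>x. \<psi> k x \<partial>\<nu>)) \<le> B * d"
        using k B by (intro mult_left_mono) auto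
      ultimately show ?case
        using elim diff_net[of u k] diff_limit[of k] d unfolding dist_real_def by linarith
    qed
  qed
qed

text \<open>The indicator of the superlevel set is discontinuous, but it lies between two ramps
  \<open>lo\<close> and \<open>hi\<close> of \<open>q\<close> whose \<nu>-integrals differ little by
  continuity of the mass at level \<open>c\<close>. Since the assumed convergence covers functions
  supported at any positive level, it applies to \<open>lo\<close>, to \<open>hi\<close> and to
  \<open>g\<close> times \<open>hi\<close>.\<close>

lemma conv_on_superlevel:
  fixes q :: "'a \<Rightarrow> real" and c :: real
  assumes q: "continuous_on UNIV q"
    and fin: "\<And>c. 0 < c \<Longrightarrow> emeasure \<nu> {x. c < q x} < \<infinity>"
    and conv: "\<And>g c. 0 < c \<Longrightarrow> bdd_continuous g \<Longrightarrow> (\<And>x. \<not> c < q x \<Longrightarrow> g x = 0) \<Longrightarrow> conv g"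
    and c: "0 < c" "isCont (\<lambda>c. measure \<nu> {x. c < q x}) c"
  shows "conv_on {x. c < q x}"
  unfolding conv_on_def
proof (intro allI impI)
  fix g :: "'a \<Rightarrow> real" assume g: "bdd_continuous g"
  let ?m = "\<lambda>c. measure \<nu> {x. c < q x}" and ?A = "{x. c < q x}"
  obtain B where B: "0 \<le> B" "\<And>x. \<bar>g x\<bar> \<le> B"
    using g by (meson bdd_continuousE)
  have meas_g: "g \<in> borel_measurable borel"
    using g by (auto simp: bdd_continuous_def intro: borel_measurable_continuous_onI)
  have op: "open {x. s < q x}" for s
    using q by (rule open_superlevel)
  show "conv (\<lambda>x. g x * indicator ?A x)"
    unfolding conv_def
  proof (rule tendstoI)
    fix e :: real assume e: "0 < e"
    define d where "d = e / (8 * (B + 1))"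
    have d: "0 < d" "B * d \<le> e / 8"
      using e B by (auto simp: d_def field_simps)
    obtain r where r: "0 < r" "\<And>s. dist s c < r \<Longrightarrow> dist (?m s) (?m c) < d"
      using c(2) d(1) unfolding continuous_at_eps_delta by blast
    \<comment> \<open>Halving the minimum keeps \<open>c - \<delta>\<close> and
      \<open>c + \<delta>\<close> inside the range where the mass varies by less than
      \<open>d\<close>, and keeps \<open>c - \<delta>\<close> positive, so that \<open>fin\<close>
      and \<open>conv\<close> apply at the lower level where \<open>hi\<close> is supported.\<close>
    define \<delta> where "\<delta> = min r c / 2"
    have \<delta>: "0 < \<delta>" "\<delta> < r" "\<delta> < c"
      using r c by (auto simp: \<delta>_def)
    define lo where "lo x = ramp c (c + \<delta>) (q x)" for x
    define hi where "hi x = ramp (c - \<delta>) c (q x)" for x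
    have lohi: "0 \<le> lo x" "lo x \<le> 1" "0 \<le> hi x" "hi x \<le> 1" for x
      by (auto simp: lo_def hi_def ramp_bounds)
    have bc: "bdd_continuous lo" "bdd_continuous hi"
      unfolding lo_def hi_def using \<delta> q by (auto intro!: bdd_continuous_ramp)
    have meas: "lo \<in> borel_measurable borel" "hi \<in> borel_measurable borel"
      using bc by (auto simp: bdd_continuous_def intro: borel_measurable_continuous_onI)
    have lo_out: "lo x = 0" if "\<not> c < q x" for x
      using that \<delta> unfolding lo_def by (intro ramp_eq_0) auto
    have hi_out: "hi x = 0" if "\<not> c - \<delta> < q x" for x
      using that \<delta> unfolding hi_def by (intro ramp_eq_0) auto
    have hi_1: "hi x = 1" if "c < q x" for x
      using that \<delta> unfolding hi_def by (intro ramp_eq_1) auto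
    have lo_1: "lo x = 1" if "c + \<delta> < q x" for x
      using that \<delta> unfolding lo_def by (intro ramp_eq_1) auto
    \<comment> \<open>On the set \<open>hi\<close> is 1 and the left side vanishes; off the set
      \<open>lo\<close> is 0 and the difference is controlled by \<open>hi\<close> alone.\<close>
    have diff: "\<bar>g x * indicator ?A x - g x * hi x\<bar> \<le> B * (hi x - lo x)" for x
    proof -
      have "\<bar>g x * indicator ?A x - g x * hi x\<bar> = \<bar>g x\<bar> * \<bar>indicator ?A x - hi x\<bar>"
        by (simp add: algebra_simps flip: abs_mult)
      also have "\<dots> \<le> B * (hi x - lo x)"
        using B lohi[of x] hi_1[of x] lo_out[of x]
        by (intro mult_mono) (auto simp: borel_measurable_indicator_open split: split_indicator)
      finally show ?thesis .
    qed
    have ghi: "bdd_continuous (\<lambda>x. g x * hi x)"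
      using g bc by (intro bdd_continuous_mult)
    have bounds: "\<bar>g x * indicator ?A x\<bar> \<le> B" "\<bar>g x * hi x\<bar> \<le> B" "\<bar>lo x\<bar> \<le> 1" "\<bar>hi x\<bar> \<le> 1" for x
      using B lohi[of x] by (auto intro!: abs_mult_le_bound split: split_indicator)
    have i1: "integrable (\<mu> u) (\<lambda>x. g x * indicator ?A x)" "integrable (\<mu> u) (\<lambda>x. g x * hi x)"
      "integrable (\<mu> u) lo" "integrable (\<mu> u) hi" for u
      by (rule integrable_net[OF _ bounds(1)] integrable_net[OF _ bounds(2)]
          integrable_net[OF _ bounds(3)] integrable_net[OF _ bounds(4)];
          use meas meas_g op in \<open>auto intro!: borel_measurable_times borel_measurable_indicator\<close>)+
    let ?S = "{x. c - \<delta> < q x}"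
    have fS: "emeasure \<nu> ?S < \<infinity>"
      using \<delta> by (intro fin) auto
    have i2: "integrable \<nu> (\<lambda>x. g x * indicator ?A x)" "integrable \<nu> (\<lambda>x. g x * hi x)"
      "integrable \<nu> lo" "integrable \<nu> hi"
      by (rule integrable_limit[OF _ bounds(1) op fS] integrable_limit[OF _ bounds(2) op fS]
          integrable_limit[OF _ bounds(3) op fS] integrable_limit[OF _ bounds(4) op fS];
          use meas meas_g op \<delta> in \<open>auto simp: lo_out hi_out intro!: borel_measurable_times borel_measurable_indicator\<close>)+
    have bound_net: "\<bar>(\<integral>x. g x * indicator ?A x \<partial>\<mu> u) - (\<integral>x. g x * hi x \<partial>\<mu> u)\<bar>
      \<le> B * ((\<integral>x. hi x \<partial>\<mu> u) - (\<integral>x. lo x \<partial>\<mu> u))" for u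
    proof -
      have "\<bar>\<integral>x. g x * indicator ?A x - g x * hi x \<partial>\<mu> u\<bar> \<le> (\<integral>x. \<bar>g x * indicator ?A x - g x * hi x\<bar> \<partial>\<mu> u)"
        by (rule integral_abs_bound)
      also have "\<dots> \<le> (\<integral>x. B * (hi x - lo x) \<partial>\<mu> u)"
        using i1[of u] diff by (intro integral_mono) auto
      finally show ?thesis
        using i1[of u] by simp
    qed
    have bound_limit: "\<bar>(\<integral>x. g x * indicator ?A x \<partial>\<nu>) - (\<integral>x. g x * hi x \<partial>\<nu>)\<bar>
      \<le> B * ((\<integral>x. hi x \<partial>\<nu>) - (\<integral>x. lo x \<partial>\<nu>))"
    proof -
      have "\<bar>\<integral>x. g x * indicator ?A x - g x * hi x \<partial>\<nu>\<bar> \<le> (\<integral>x. \<bar>g x * indicator ?A x - g x * hi x\<bar> \<partial>\<nu>)"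
        by (rule integral_abs_bound)
      also have "\<dots> \<le> (\<integral>x. B * (hi x - lo x) \<partial>\<nu>)"
        using i2 diff by (intro integral_mono) auto
      finally show ?thesis
        using i2 by simp
    qed
    have hi_le: "(\<integral>x. hi x \<partial>\<nu>) \<le> ?m (c - \<delta>)"
      using fS lohi hi_out meas by (intro integral_limit_le op) (auto simp: borel_measurable_indicator_open split: split_indicator)
    have lo_ge: "?m (c + \<delta>) \<le> (\<integral>x. lo x \<partial>\<nu>)"
    proof -
      have "(\<integral>x. indicator {x. c + \<delta> < q x} x \<partial>\<nu>) \<le> (\<integral>x. lo x \<partial>\<nu>)"
        using fin[of "c + \<delta>"] \<delta> lo_1 lohi op
        by (intro integral_mono i2 integrable_limit[where B = 1 and S = "{x. c + \<delta> < q x}"]) (auto simp: borel_measurable_indicator_open split: split_indicator)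
      then show ?thesis
        by (simp add: open_in_sets op)
    qed
    have "dist (?m (c - \<delta>)) (?m c) < d" "dist (?m (c + \<delta>)) (?m c) < d"
      using \<delta> by (intro r(2); simp add: dist_real_def)+
    then have gap: "(\<integral>x. hi x \<partial>\<nu>) - (\<integral>x. lo x \<partial>\<nu>) < 2 * d"
      using hi_le lo_ge by (simp add: dist_real_def)
    have "conv (\<lambda>x. g x * hi x)" "conv hi"
      using ghi bc(2) hi_out \<delta> by (auto intro!: conv[of "c - \<delta>"])
    moreover have "conv lo"
      using bc(1) lo_out c by (intro conv[of c]) auto
    ultimately have "conv (\<lambda>x. g x * hi x)" "conv hi" "conv lo"
      by auto
    note lims = this[unfolded conv_def]
    have lim1: "\<forall>\<^sub>F u in F. dist (\<integral>x. g x * hi x \<partial>\<mu> u) (\<integral>x. g x * hi x \<partial>\<nu>) < e / 8"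
      using e by (intro tendstoD[OF lims(1)]) simp
    have lim2: "((\<lambda>u. (\<integral>x. hi x \<partial>\<mu> u) - (\<integral>x. lo x \<partial>\<mu> u)) \<longlongrightarrow> (\<integral>x. hi x \<partial>\<nu>) - (\<integral>x. lo x \<partial>\<nu>)) F"
      by (rule tendsto_diff[OF lims(2,3)])
    show "\<forall>\<^sub>F u in F. dist (\<integral>x. g x * indicator ?A x \<partial>\<mu> u) (\<integral>x. g x * indicator ?A x \<partial>\<nu>) < e"
      using lim1 order_tendstoD(2)[OF lim2 gap]
    proof eventually_elim
      case (elim u)
      have "B * ((\<integral>x. hi x \<partial>\<mu> u) - (\<integral>x. lo x \<partial>\<mu> u)) \<le> B * (2 * d)"
        using elim B by (intro mult_left_mono) auto
      moreover have "B * ((\<integral>x. hi x \<partial>\<nu>) - (\<integral>x. lo x \<partial>\<nu>)) \<le> B * (2 * d)"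
        using gap B by (intro mult_left_mono) auto
      ultimately show ?case
        using elim bound_net[of u] bound_limit d unfolding dist_real_def
        by linarith
    qed
  qed
qed

end

section \<open>The topology of the field space\<close>

lemma continuous_on_apply_cfun: "continuous_on S (apply_cfun f)"
  using apply_cfun[of f] by (auto intro: continuous_on_subset)

text \<open>Uniform balls over compact sets are neighbourhoods, so a functional that is 1-Lipschitz
  for the uniform distance over one compact set is continuous. Evaluations, suprema over compact
  sets and minima of these are all of this kind.\<close>

lemma continuous_on_cfunI:
  fixes q :: "('t::topological_space, 'q::finite) cfun \<Rightarrow> real"
  assumes "compact K"
    and "\<And>f g d. (\<And>t. t \<in> K \<Longrightarrow> dist (apply_cfun g t) (apply_cfun f t) \<le> d) \<Longrightarrow> 0 < d \<Longrightarrow> \<bar>q g - q f\<bar> \<le> d"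
  shows "continuous_on UNIV q"
  unfolding continuous_on_open_vimage[OF open_UNIV]
proof (intro allI impI)
  fix B :: "real set" assume B: "open B"
  show "open (q -` B \<inter> UNIV)"
    unfolding open_cfun_def
  proof
    fix f assume "f \<in> q -` B \<inter> UNIV"
    then obtain e where e: "0 < e" "ball (q f) e \<subseteq> B"
      using B open_contains_ball by blast
    have "g \<in> q -` B \<inter> UNIV" if "\<forall>t\<in>K. dist (apply_cfun g t) (apply_cfun f t) < e / 2" for g
    proof -
      have "\<bar>q g - q f\<bar> \<le> e / 2"
        using that e by (intro assms(2)) (auto intro: less_imp_le)
      then have "q g \<in> ball (q f) e"
        using e unfolding mem_ball dist_real_def by linarith
      with e show ?thesis by auto
    qed
    then show "\<exists>K e. compact K \<and> 0 < e \<and> {g. \<forall>t\<in>K. dist (apply_cfun g t) (apply_cfun f t) < e} \<subseteq> q -` B \<inter> UNIV"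
      using assms(1) e by (intro exI[of _ K] exI[of _ "e / 2"]) auto
  qed
qed

text \<open>Openness is not immediate, since the topology is given by a neighbourhood condition. On
  a compact set the distance to the centre attains its maximum, so a point of the ball has positive
  room left before \<open>e\<close>.\<close>

lemma open_uniform_ball:
  fixes f :: "('t::topological_space, 'q::finite) cfun"
  assumes K: "compact K" and e: "0 < e"
  shows "open {g. \<forall>t\<in>K. dist (apply_cfun g t) (apply_cfun f t) < e}"
  unfolding open_cfun_def
proof
  fix g assume g: "g \<in> {g. \<forall>t\<in>K. dist (apply_cfun g t) (apply_cfun f t) < e}"
  have "\<exists>d>0. \<forall>t\<in>K. dist (apply_cfun g t) (apply_cfun f t) + d \<le> e"
  proof (cases "K = {}")
    case False
    have "continuous_on K (\<lambda>t. dist (apply_cfun g t) (apply_cfun f t))"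
      by (intro continuous_intros continuous_on_apply_cfun)
    then obtain s where s: "s \<in> K"
      "\<And>t. t \<in> K \<Longrightarrow> dist (apply_cfun g t) (apply_cfun f t) \<le> dist (apply_cfun g s) (apply_cfun f s)"
      using continuous_attains_sup[OF K False] by blast
    with g show ?thesis
      by (intro exI[of _ "e - dist (apply_cfun g s) (apply_cfun f s)"]) auto
  qed (use e in auto)
  then obtain d where d: "0 < d" "\<And>t. t \<in> K \<Longrightarrow> dist (apply_cfun g t) (apply_cfun f t) + d \<le> e"
    by blast
  have "dist (apply_cfun h t) (apply_cfun f t) < e"
    if "\<forall>t\<in>K. dist (apply_cfun h t) (apply_cfun g t) < d" "t \<in> K" for h t
    using that d(2)[of t] dist_triangle[of "apply_cfun h t" "apply_cfun f t" "apply_cfun g t"] by force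
  then show "\<exists>K' d. compact K' \<and> 0 < d \<and> {h. \<forall>t\<in>K'. dist (apply_cfun h t) (apply_cfun g t) < d}
      \<subseteq> {g. \<forall>t\<in>K. dist (apply_cfun g t) (apply_cfun f t) < e}"
    using K d(1) by blast
qed

lemma norm_vec_mult_le:
  fixes a x :: "real ^ 'q::finite"
  shows "norm (\<chi> i. a $ i * x $ i) \<le> norm a * norm x"
proof -
  have "norm (\<chi> i. a $ i * x $ i) \<le> norm (norm a *\<^sub>R x)"
    by (rule norm_le_componentwise_cart) (simp add: abs_mult mult_right_mono component_le_norm_cart)
  then show ?thesis
    by simp
qed

text \<open>Joint continuity of the scaling, stated with a neighbourhood for each argument: it gives
  continuity for fixed \<open>r\<close> as well as the boxes needed for joint measurability.\<close>

lemma scale_cfun_nhds: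
  fixes f0 :: "('t::topological_space, 'q::finite) cfun"
  assumes U: "open U" "scale_cfun r0 f0 \<in> U"
  obtains \<delta> V where "0 < \<delta>" "open V" "f0 \<in> V" "\<And>r f. r \<in> ball r0 \<delta> \<Longrightarrow> f \<in> V \<Longrightarrow> scale_cfun r f \<in> U"
proof -
  obtain K e where K: "compact K" "0 < e"
    "{g. \<forall>t\<in>K. dist (apply_cfun g t) (apply_cfun (scale_cfun r0 f0) t) < e} \<subseteq> U"
    using U unfolding open_cfun_def by meson
  have "bounded (apply_cfun f0 ` K)"
    using K by (intro compact_imp_bounded compact_continuous_image continuous_on_apply_cfun)
  then obtain B where B: "0 < B" "\<And>t. t \<in> K \<Longrightarrow> norm (apply_cfun f0 t) \<le> B"
    by (auto simp: bounded_pos)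
  \<comment> \<open>The constants come from writing the difference as \<open>r\<close> acting on
    \<open>f - f0\<close> plus \<open>r - r0\<close> acting on \<open>f0\<close>. With
    \<open>\<delta> \<le> 1\<close> the norm of \<open>r\<close> is at most
    \<open>norm r0 + 1\<close>, and each of the two terms is bounded by
    \<open>e / 2\<close>.\<close>
  define \<delta> where "\<delta> = min 1 (e / (2 * B))"
  define \<eta> where "\<eta> = e / (2 * (norm r0 + 1))"
  have \<delta>: "0 < \<delta>" "\<delta> \<le> 1" "\<delta> * B \<le> e / 2"
    using K B by (auto simp: \<delta>_def min_def field_simps)
  have nr: "0 < norm r0 + 1"
    using norm_ge_zero[of r0] by linarith
  then have \<eta>: "0 < \<eta>" "(norm r0 + 1) * \<eta> = e / 2"
    using K by (auto simp: \<eta>_def field_simps)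
  let ?V = "{g. \<forall>t\<in>K. dist (apply_cfun g t) (apply_cfun f0 t) < \<eta>}"
  show ?thesis
  proof (rule that[OF \<delta>(1), of ?V])
    show "open ?V"
      using K \<eta> by (intro open_uniform_ball)
    show "f0 \<in> ?V"
      using \<eta> by simp
    fix r f assume r: "r \<in> ball r0 \<delta>" and f: "f \<in> ?V"
    have "dist (apply_cfun (scale_cfun r f) t) (apply_cfun (scale_cfun r0 f0) t) < e" if t: "t \<in> K" for t
    proof -
      let ?x = "apply_cfun f t" and ?y = "apply_cfun f0 t"
      have dr: "norm (r - r0) < \<delta>"
        using r by (simp add: dist_norm norm_minus_commute)
      have "norm r \<le> norm r0 + 1"
        using norm_triangle_ineq[of r0 "r - r0"] dr \<delta> by simp
      have "apply_cfun (scale_cfun r f) t - apply_cfun (scale_cfun r0 f0) t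
        = (\<chi> i. r $ i * (?x - ?y) $ i) + (\<chi> i. (r - r0) $ i * ?y $ i)"
        by (simp add: scale_cfun.rep_eq vec_eq_iff algebra_simps)
      then have "norm (apply_cfun (scale_cfun r f) t - apply_cfun (scale_cfun r0 f0) t)
        \<le> norm (\<chi> i. r $ i * (?x - ?y) $ i) + norm (\<chi> i. (r - r0) $ i * ?y $ i)"
        by (simp only: norm_triangle_ineq)
      also have "\<dots> \<le> norm r * norm (?x - ?y) + norm (r - r0) * norm ?y"
        by (intro add_mono norm_vec_mult_le)
      also have "\<dots> \<le> (norm r0 + 1) * norm (?x - ?y) + \<delta> * B"
        using \<open>norm r \<le> norm r0 + 1\<close> dr B t \<delta> by (intro add_mono mult_mono) auto
      also have "\<dots> < (norm r0 + 1) * \<eta> + \<delta> * B"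
        using f t nr by (auto simp: dist_norm intro!: mult_strict_left_mono)
      also have "\<dots> \<le> e"
        using \<delta> \<eta> by simp
      finally show ?thesis
        by (simp add: dist_norm)
    qed
    then show "scale_cfun r f \<in> U"
      using K(3) by auto
  qed
qed

lemma continuous_on_scale_cfun:
  fixes r :: "real ^ 'q::finite"
  shows "continuous_on UNIV (scale_cfun r :: ('t::topological_space, 'q) cfun \<Rightarrow> _)"
  unfolding continuous_on_open_vimage[OF open_UNIV]
proof (intro allI impI)
  fix U :: "('t, 'q) cfun set" assume U: "open U"
  show "open (scale_cfun r -` U \<inter> UNIV)"
  proof (subst open_subopen, intro ballI)
    fix f assume "f \<in> scale_cfun r -` U \<inter> UNIV"
    then have "scale_cfun r f \<in> U"
      by simp
    from scale_cfun_nhds[OF U this] obtain \<delta> V where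
      "0 < \<delta>" "open V" "f \<in> V" "\<And>s g. s \<in> ball r \<delta> \<Longrightarrow> g \<in> V \<Longrightarrow> scale_cfun s g \<in> U"
      by blast
    then show "\<exists>T. open T \<and> f \<in> T \<and> T \<subseteq> scale_cfun r -` U \<inter> UNIV"
      by (intro exI[of _ V]) auto
  qed
qed

lemma measurable_scale_cfun: "scale_cfun r \<in> borel_measurable borel"
  by (rule borel_measurable_continuous_onI[OF continuous_on_scale_cfun])

text \<open>Second countability of \<open>real ^ 'q\<close> suffices: an open set of the product is a countable
  union of open boxes over a countable base of the first factor.\<close>

lemma measurable_scale_cfun_pair:
  "(\<lambda>(r, f). scale_cfun r f) \<in> borel \<Otimes>\<^sub>M borel \<rightarrow>\<^sub>M
     (borel :: ('t::topological_space, 'q::finite) cfun measure)"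
proof (rule borel_measurableI)
  fix U :: "('t, 'q) cfun set" assume U: "open U"
  obtain \<B> :: "(real ^ 'q) set set" where \<B>: "countable \<B>" "topological_basis \<B>"
    using ex_countable_basis by blast
  \<comment> \<open>All open second factors admissible for \<open>B\<close> are merged into one open
    set, so a single box per base set suffices and the union stays countable.\<close>
  define V :: "(real ^ 'q) set \<Rightarrow> ('t, 'q) cfun set" where
    "V B = \<Union>{W. open W \<and> (\<forall>r\<in>B. \<forall>f\<in>W. scale_cfun r f \<in> U)}" for B
  have V: "open (V B)" for B
    unfolding V_def by auto
  have "(\<lambda>(r, f). scale_cfun r f) -` U = (\<Union>B\<in>\<B>. B \<times> V B)"
  proof (intro set_eqI iffI)
    fix x assume x: "x \<in> (\<lambda>(r, f). scale_cfun r f) -` U"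
    obtain r f where rf: "x = (r, f)"
      by (cases x)
    from x have "scale_cfun r f \<in> U"
      by (simp add: rf)
    from scale_cfun_nhds[OF U this] obtain \<delta> W where
      W: "0 < \<delta>" "open W" "f \<in> W" "\<And>s g. s \<in> ball r \<delta> \<Longrightarrow> g \<in> W \<Longrightarrow> scale_cfun s g \<in> U"
      by blast
    obtain B where "B \<in> \<B>" "r \<in> B" "B \<subseteq> ball r \<delta>"
      using topological_basisE[OF \<B>(2), of "ball r \<delta>" r] W(1) by auto
    then show "x \<in> (\<Union>B\<in>\<B>. B \<times> V B)"
      using W unfolding rf V_def by blast
  qed (auto simp: V_def)
  moreover have "(\<Union>B\<in>\<B>. B \<times> V B) \<in> sets (borel \<Otimes>\<^sub>M borel)"
    using \<B> V by (intro sets.countable_UN'' pair_measureI borel_open) (auto intro: topological_basis_open)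
  ultimately show "(\<lambda>(r, f). scale_cfun r f) -` U \<inter> space (borel \<Otimes>\<^sub>M borel) \<in> sets (borel \<Otimes>\<^sub>M borel)"
    by (simp add: space_pair_measure)
qed

section \<open>Continuity and homogeneity of the level functionals\<close>

lemma abs_Min_diff_le:
  fixes a b :: "'q::finite \<Rightarrow> real"
  assumes "\<And>i. \<bar>a i - b i\<bar> \<le> d"
  shows "\<bar>(MIN i. a i) - (MIN i. b i)\<bar> \<le> d"
proof -
  have 1: "(MIN i. a i) \<le> (MIN i. b i) + d" if "\<And>i. \<bar>a i - b i\<bar> \<le> d" for a b :: "'q \<Rightarrow> real"
  proof -
    have "(MIN i. b i) \<in> range b"
      by (intro Min_in) auto
    then obtain i where i: "(MIN i. b i) = b i"
      by blast
    have "(MIN i. a i) \<le> a i"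
      by (intro Min_le) auto
    then show ?thesis
      using that[of i] i by linarith
  qed
  have "\<bar>b i - a i\<bar> \<le> d" for i
    using assms[of i] by linarith
  then have "(MIN i. b i) \<le> (MIN i. a i) + d"
    by (rule 1)
  moreover have "(MIN i. a i) \<le> (MIN i. b i) + d"
    using assms by (rule 1)
  ultimately show ?thesis
    by linarith
qed

lemma less_Min_UNIV_iff: "c < (MIN i. a i) \<longleftrightarrow> (\<forall>i::'q::finite. c < (a i :: real))"
  by (subst Min_gr_iff) auto

lemma Min_mult_left_UNIV:
  fixes a :: "'q::finite \<Rightarrow> real"
  assumes "0 < c"
  shows "(MIN i. c * a i) = c * (MIN i. a i)"
proof -
  have "c * Min (range a) = Min ((\<lambda>x. c * x) ` range a)"
    using assms by (intro mono_Min_commute) (auto simp: mono_def)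
  then show ?thesis
    by (simp add: image_image)
qed

lemma component_diff_le_dist: "\<bar>\<bar>x $ i\<bar> - \<bar>y $ i\<bar>\<bar> \<le> dist x (y :: real ^ 'q::finite)"
proof -
  have "\<bar>(x - y) $ i\<bar> \<le> norm (x - y)"
    by (rule component_le_norm_cart)
  then show ?thesis
    by (simp add: dist_norm)
qed

lemma bdd_above_rho:
  fixes f :: "('t::topological_space, 'q::finite) cfun"
  assumes "compact K"
  shows "bdd_above ((\<lambda>t. \<bar>apply_cfun f t $ i\<bar>) ` K)"
  using assms
  by (intro bounded_imp_bdd_above compact_imp_bounded compact_continuous_image continuous_intros
      continuous_on_apply_cfun)

lemma rho_upper: "compact (K n) \<Longrightarrow> t \<in> K n \<Longrightarrow> \<bar>apply_cfun f t $ i\<bar> \<le> rho K n i f"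
  unfolding rho_def by (intro cSUP_upper bdd_above_rho)

lemma less_rho_iff:
  "compact (K n) \<Longrightarrow> K n \<noteq> {} \<Longrightarrow> c < rho K n i f \<longleftrightarrow> (\<exists>t\<in>K n. c < \<bar>apply_cfun f t $ i\<bar>)"
  unfolding rho_def by (intro less_cSUP_iff bdd_above_rho)

lemma rho_diff_le:
  assumes "compact (K n)" "K n \<noteq> {}"
    and "\<And>t. t \<in> K n \<Longrightarrow> dist (apply_cfun g t) (apply_cfun f t) \<le> d"
  shows "\<bar>rho K n i g - rho K n i f\<bar> \<le> d"
proof -
  have 1: "rho K n i g \<le> rho K n i f + d"
    if "\<And>t. t \<in> K n \<Longrightarrow> dist (apply_cfun g t) (apply_cfun f t) \<le> d" for f g
    unfolding rho_def[of K n i g]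
  proof (rule cSUP_least[OF assms(2)])
    fix t assume "t \<in> K n"
    then show "\<bar>apply_cfun g t $ i\<bar> \<le> rho K n i f + d"
      using rho_upper[of K n t f i] that[of t] assms(1) component_diff_le_dist[of "apply_cfun g t" i "apply_cfun f t"]
      by linarith
  qed
  have "rho K n i g \<le> rho K n i f + d" "rho K n i f \<le> rho K n i g + d"
    using assms(3) by (auto intro!: 1 simp: dist_commute)
  then show ?thesis
    by (auto simp: abs_le_iff)
qed

definition anchor_level :: "('q::finite \<Rightarrow> 't::topological_space) \<Rightarrow> ('t, 'q) cfun \<Rightarrow> real" where
  "anchor_level h f = (MIN i. \<bar>apply_cfun f (h i) $ i\<bar>)"

definition joint_level :: "(nat \<Rightarrow> 't::topological_space set) \<Rightarrow> nat \<Rightarrow> ('t, 'q::finite) cfun \<Rightarrow> real" where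
  "joint_level K n f = (MIN i. rho K n i f)"

lemma anchor_set_eq: "anchor_set h = {f. 1 < anchor_level h f}"
  by (auto simp: anchor_set_def anchor_level_def less_Min_UNIV_iff)

lemma joint_set_eq: "joint_set K n = {f. 1 / real n < joint_level K n f}"
  by (auto simp: joint_set_def joint_level_def)

lemma continuous_on_anchor_level:
  fixes h :: "'q::finite \<Rightarrow> 't::topological_space"
  shows "continuous_on UNIV (anchor_level h)"
proof (rule continuous_on_cfunI)
  show "compact (range h)"
    by (intro finite_imp_compact) auto
  fix f g :: "('t, 'q) cfun" and d assume *: "\<And>t. t \<in> range h \<Longrightarrow> dist (apply_cfun g t) (apply_cfun f t) \<le> d"
  have "\<bar>\<bar>apply_cfun g (h i) $ i\<bar> - \<bar>apply_cfun f (h i) $ i\<bar>\<bar> \<le> d" for i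
    using component_diff_le_dist *[of "h i"] by (rule order_trans) auto
  then show "\<bar>anchor_level h g - anchor_level h f\<bar> \<le> d"
    unfolding anchor_level_def by (rule abs_Min_diff_le)
qed

lemma continuous_on_joint_level:
  assumes "compact (K n)" "K n \<noteq> {}"
  shows "continuous_on UNIV (joint_level K n)"
proof (rule continuous_on_cfunI[OF assms(1)])
  fix f g d assume "\<And>t. t \<in> K n \<Longrightarrow> dist (apply_cfun g t) (apply_cfun f t) \<le> d"
  then show "\<bar>joint_level K n g - joint_level K n f\<bar> \<le> d"
    unfolding joint_level_def by (intro abs_Min_diff_le rho_diff_le assms)
qed

lemma continuous_on_rho:
  assumes "compact (K n)" "K n \<noteq> {}"
  shows "continuous_on UNIV (rho K n i)"
  by (rule continuous_on_cfunI[OF assms(1)]) (rule rho_diff_le[of K n, OF assms])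

lemma rho_scale:
  assumes "compact (K n)" "K n \<noteq> {}" "0 < r $ i"
  shows "rho K n i (scale_cfun r f) = r $ i * rho K n i f"
proof (rule antisym)
  show "rho K n i (scale_cfun r f) \<le> r $ i * rho K n i f"
    unfolding rho_def[of K n i "scale_cfun r f"]
    using assms rho_upper[of K n _ f i]
    by (intro cSUP_least) (auto simp: scale_cfun.rep_eq abs_mult)
  have "rho K n i f \<le> rho K n i (scale_cfun r f) / r $ i"
    unfolding rho_def[of K n i f]
  proof (rule cSUP_least[OF assms(2)])
    fix t assume "t \<in> K n"
    then show "\<bar>apply_cfun f t $ i\<bar> \<le> rho K n i (scale_cfun r f) / r $ i"
      using assms rho_upper[of K n t "scale_cfun r f" i]
      by (simp add: scale_cfun.rep_eq abs_mult field_simps)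
  qed
  then show "r $ i * rho K n i f \<le> rho K n i (scale_cfun r f)"
    using assms by (simp add: field_simps)
qed

lemma anchor_level_scale:
  "0 < c \<Longrightarrow> anchor_level h (scale_cfun (vec c) f) = c * anchor_level h f"
  by (simp add: anchor_level_def scale_cfun.rep_eq abs_mult Min_mult_left_UNIV)

lemma joint_level_scale:
  "compact (K n) \<Longrightarrow> K n \<noteq> {} \<Longrightarrow> 0 < c \<Longrightarrow> joint_level K n (scale_cfun (vec c) f) = c * joint_level K n f"
  by (simp add: joint_level_def rho_scale Min_mult_left_UNIV)

lemma open_nonzero_fields: "open (nonzero_fields :: ('t::topological_space, 'q::finite) cfun set)"
proof -
  have c: "continuous_on UNIV (\<lambda>f :: ('t, 'q) cfun. \<bar>apply_cfun f t $ i\<bar>)" for t i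
    using component_diff_le_dist
    by (intro continuous_on_cfunI[of "{t}"]) (auto intro: order_trans)
  have "nonzero_fields = (\<Inter>i. \<Union>t. {f :: ('t, 'q) cfun. 0 < \<bar>apply_cfun f t $ i\<bar>})"
    by (auto simp: nonzero_fields_def)
  moreover have "open {f :: ('t, 'q) cfun. 0 < \<bar>apply_cfun f t $ i\<bar>}" for t i
    using open_Collect_less[of "\<lambda>_. 0" "\<lambda>f :: ('t, 'q) cfun. \<bar>apply_cfun f t $ i\<bar>"] c by simp
  then have "open (\<Inter>i. \<Union>t. {f :: ('t, 'q) cfun. 0 < \<bar>apply_cfun f t $ i\<bar>})"
    by (intro open_INT open_UN ballI) auto
  ultimately show ?thesis
    by (simp only:)
qed

lemma scale_cfun_scale_cfun:
  "scale_cfun r (scale_cfun s f) = scale_cfun (\<chi> i. r $ i * s $ i) f"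
  by (simp add: apply_cfun_inject[symmetric] scale_cfun.rep_eq vec_eq_iff fun_eq_iff)

lemma nonzero_fields_scale:
  assumes "\<And>i. r $ i \<noteq> 0"
  shows "scale_cfun r f \<in> nonzero_fields \<longleftrightarrow> f \<in> nonzero_fields"
  using assms by (auto simp: nonzero_fields_def scale_cfun.rep_eq)

section \<open>The target measure\<close>

text \<open>Tonelli for Lebesgue measure is stated over \<open>Basis\<close>; here the basis vectors
  are \<open>axis i 1\<close>, and the inner product with one of them is the \<open>i\<close>-th
  coordinate.\<close>

lemma nn_integral_lborel_vec_prod:
  fixes F :: "'q::finite \<Rightarrow> real \<Rightarrow> ennreal"
  assumes [measurable]: "\<And>i. F i \<in> borel_measurable borel"
  shows "(\<integral>\<^sup>+x. (\<Prod>i\<in>UNIV. F i (x $ i)) \<partial>(lborel :: (real ^ 'q) measure)) = (\<Prod>i\<in>UNIV. \<integral>\<^sup>+x. F i x \<partial>lborel)"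
proof -
  have B: "(Basis :: (real ^ 'q) set) = range (\<lambda>i. axis i 1)"
    by (auto simp: Basis_vec_def)
  have inj: "inj (\<lambda>i::'q. axis i (1::real))"
    by (auto simp: inj_def axis_eq_axis)
  have P: "(\<Prod>b\<in>(Basis :: (real ^ 'q) set). g b) = (\<Prod>i\<in>UNIV. g (axis i 1))" for g :: "real ^ 'q \<Rightarrow> ennreal"
    unfolding B by (subst prod.reindex[OF inj]) simp
  have "(\<integral>\<^sup>+x. (\<Prod>b\<in>Basis. F (axis_index b) (x \<bullet> b)) \<partial>(lborel :: (real ^ 'q) measure))
      = (\<Prod>b\<in>(Basis :: (real ^ 'q) set). \<integral>\<^sup>+x. F (axis_index b) x \<partial>lborel)"
    by (intro nn_integral_lborel_prod) auto
  then show ?thesis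
    unfolding P by (simp add: cart_eq_inner_axis[symmetric])
qed

text \<open>One coordinate factor of the density of \<open>theta\<close>, extended by 0 to the left
  half line so that the restriction to the orthant is absorbed into the product. It is not a
  probability density: the tail beyond \<open>d\<close> has mass
  \<open>d powr (- a)\<close>.\<close>

definition pareto :: "real \<Rightarrow> real \<Rightarrow> real" where
  "pareto a x = (if 0 < x then a * x powr (- a - 1) else 0)"

lemma borel_measurable_pareto [measurable]: "pareto a \<in> borel_measurable borel"
  unfolding pareto_def by measurable

lemma pareto_nonneg: "0 < a \<Longrightarrow> 0 \<le> pareto a x"
  by (simp add: pareto_def)

lemma pareto_scale:
  assumes "0 < c"
  shows "pareto a (c * x) = c powr (- a - 1) * pareto a x"
  using assms by (auto simp: pareto_def powr_mult zero_less_mult_iff)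

lemma pareto_tail:
  assumes a: "0 < a" and d: "0 < d"
  shows "(\<integral>\<^sup>+x. ennreal (pareto a x) * indicator {d..} x \<partial>lborel) = ennreal (d powr (- a))"
proof -
  have "(\<integral>\<^sup>+x. ennreal (pareto a x) * indicator {d..} x \<partial>lborel)
      = (\<integral>\<^sup>+x. ennreal (a * x powr (- a - 1)) * indicator {d..} x \<partial>lborel)"
    using d by (intro nn_integral_cong) (auto simp: pareto_def split: split_indicator)
  also have "\<dots> = ennreal (0 - (- (d powr (- a))))"
  proof (rule nn_integral_FTC_atLeast)
    show "((\<lambda>x. - (x powr (- a))) has_real_derivative a * x powr (- a - 1)) (at x)" if "d \<le> x" for x
      using that d by (auto intro!: derivative_eq_intros)
    show "((\<lambda>x. - (x powr (- a))) \<longlongrightarrow> 0) at_top"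
      using tendsto_minus[OF tendsto_neg_powr[of "- a" "\<lambda>x. x" at_top]] a by (simp add: filterlim_ident)
  qed (use a in auto)
  finally show ?thesis
    by simp
qed

lemma pareto_tail_le:
  assumes a: "0 < a" and c: "0 < c" and p: "0 \<le> p"
  shows "(\<integral>\<^sup>+x. ennreal (pareto a x) * indicator {x. c < x * p} x \<partial>lborel) \<le> ennreal ((p / c) powr a)"
proof (cases "p = 0")
  case True
  with c show ?thesis
    by simp
next
  case False
  with p have p: "0 < p"
    by simp
  have "(\<integral>\<^sup>+x. ennreal (pareto a x) * indicator {x. c < x * p} x \<partial>lborel)
      \<le> (\<integral>\<^sup>+x. ennreal (pareto a x) * indicator {c / p..} x \<partial>lborel)"
    using p by (intro nn_integral_mono) (auto simp: field_simps split: split_indicator)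
  also have "\<dots> = ennreal ((c / p) powr (- a))"
    using a c p by (intro pareto_tail) auto
  also have "(c / p) powr (- a) = (p / c) powr a"
    using c p by (simp add: powr_minus powr_divide field_simps)
  finally show ?thesis
    by simp
qed

lemma measurable_vec_nth_borel [measurable]: "(\<lambda>x. x $ i) \<in> borel_measurable (borel :: (real ^ 'q::finite) measure)"
  by (intro borel_measurable_continuous_onI continuous_intros)

lemma pos_orthant_nth: "\<alpha> \<in> pos_orthant \<Longrightarrow> 0 < \<alpha> $ i"
  by (simp add: pos_orthant_def)

lemma theta_eq:
  assumes "\<alpha> \<in> pos_orthant"
  shows "theta \<alpha> = density lborel (\<lambda>r. \<Prod>i\<in>UNIV. ennreal (pareto (\<alpha> $ i) (r $ i)))"
  unfolding theta_def
proof (intro arg_cong[where f = "density lborel"] ext)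
  fix r
  have "(\<Prod>i\<in>UNIV. ennreal (pareto (\<alpha> $ i) (r $ i))) = ennreal (\<Prod>i\<in>UNIV. pareto (\<alpha> $ i) (r $ i))"
    using assms by (intro prod_ennreal pareto_nonneg) (simp add: pos_orthant_nth)
  also have "\<dots> = (if r \<in> pos_orthant then ennreal (\<Prod>i\<in>UNIV. \<alpha> $ i * r $ i powr (- \<alpha> $ i - 1)) else 0)"
  proof (cases "r \<in> pos_orthant")
    case True
    then have "pareto (\<alpha> $ i) (r $ i) = \<alpha> $ i * r $ i powr (- \<alpha> $ i - 1)" for i
      by (simp add: pos_orthant_def pareto_def)
    with True show ?thesis
      by simp
  next
    case False
    then have "(\<Prod>i\<in>UNIV. pareto (\<alpha> $ i) (r $ i)) = 0"
      by (intro prod_zero) (auto simp: pos_orthant_def pareto_def)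
    with False show ?thesis
      by (simp only: if_False ennreal_0)
  qed
  finally show "(if r \<in> pos_orthant then ennreal (\<Prod>i\<in>UNIV. \<alpha> $ i * r $ i powr (- \<alpha> $ i - 1)) else 0)
      = (\<Prod>i\<in>UNIV. ennreal (pareto (\<alpha> $ i) (r $ i)))"
    by simp
qed

lemma sets_theta [measurable_cong]: "sets (theta \<alpha>) = sets borel"
  by (simp add: theta_def)

lemma space_theta: "space (theta \<alpha>) = UNIV"
  by (simp add: theta_def)

lemma nn_integral_theta:
  assumes "\<alpha> \<in> pos_orthant" "h \<in> borel_measurable borel"
  shows "(\<integral>\<^sup>+r. h r \<partial>theta \<alpha>) = (\<integral>\<^sup>+r. (\<Prod>i\<in>UNIV. ennreal (pareto (\<alpha> $ i) (r $ i))) * h r \<partial>lborel)"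
  using assms unfolding theta_eq[OF assms(1)] by (subst nn_integral_density) auto

text \<open>The density is finite everywhere and Lebesgue measure is \<sigma>-finite. This permits
  Tonelli on the product with the law of the representer.\<close>

lemma sigma_finite_theta:
  assumes "\<alpha> \<in> pos_orthant"
  shows "sigma_finite_measure (theta \<alpha>)"
proof -
  have "(\<Prod>i\<in>UNIV. ennreal (pareto (\<alpha> $ i) (r $ i))) \<noteq> \<infinity>" for r
    using assms by (subst prod_ennreal) (auto simp: pareto_nonneg pos_orthant_nth)
  then show ?thesis
    unfolding theta_eq[OF assms]
    by (subst sigma_finite_measure.sigma_finite_iff_density_finite[OF sigma_finite_lborel]) auto
qed

lemma AE_theta_pos:
  assumes "\<alpha> \<in> pos_orthant"
  shows "AE r in theta \<alpha>. r \<in> pos_orthant"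
proof -
  have "r \<in> pos_orthant" if "0 < (\<Prod>i\<in>UNIV. ennreal (pareto (\<alpha> $ i) (r $ i)))" for r
  proof (rule ccontr)
    assume "r \<notin> pos_orthant"
    then have "(\<Prod>i\<in>UNIV. ennreal (pareto (\<alpha> $ i) (r $ i))) = 0"
      by (intro prod_zero) (auto simp: pos_orthant_def pareto_def)
    with that show False
      by simp
  qed
  then show ?thesis
    unfolding theta_eq[OF assms] by (subst AE_density) auto
qed

text \<open>The substitution contributes one factor \<open>c\<close> per coordinate from Lebesgue
  measure and \<open>c powr (- \<alpha> $ i - 1)\<close> from each density factor; together they
  leave the exponent minus the sum of the \<open>\<alpha> $ i\<close>.\<close>

lemma theta_scale:
  fixes \<alpha> :: "real ^ 'q::finite"
  assumes \<alpha>: "\<alpha> \<in> pos_orthant" and c: "0 < c" and h [measurable]: "h \<in> borel_measurable borel"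
  shows "(\<integral>\<^sup>+r. h r \<partial>theta \<alpha>) = ennreal (c powr (- (\<Sum>i\<in>UNIV. \<alpha> $ i))) * (\<integral>\<^sup>+r. h (c *\<^sub>R r) \<partial>theta \<alpha>)"
proof -
  let ?d = "\<lambda>r :: real ^ 'q. \<Prod>i\<in>UNIV. ennreal (pareto (\<alpha> $ i) (r $ i))"
  have L: "(lborel :: (real ^ 'q) measure)
      = density (distr lborel borel (\<lambda>x. c *\<^sub>R x)) (\<lambda>_. ennreal (c ^ CARD('q)))"
    using lborel_affine[of c "0 :: real ^ 'q"] c by (simp add: ennreal_power)
  have "?d (c *\<^sub>R r) = ennreal (\<Prod>i\<in>UNIV. c powr (- \<alpha> $ i - 1)) * ?d r" for r
    using \<alpha> c by (simp add: pareto_scale ennreal_mult' prod.distrib prod_ennreal[symmetric])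
  moreover have "c ^ CARD('q) * (\<Prod>i\<in>UNIV. c powr (- \<alpha> $ i - 1)) = c powr (- (\<Sum>i\<in>UNIV. \<alpha> $ i))"
  proof -
    have "c ^ CARD('q) * (\<Prod>i\<in>UNIV. c powr (- \<alpha> $ i - 1)) = (\<Prod>i\<in>UNIV. c * c powr (- \<alpha> $ i - 1))"
      by (simp add: prod.distrib)
    also have "\<dots> = (\<Prod>i\<in>UNIV. c powr (- \<alpha> $ i))"
      using c by (intro prod.cong) (auto simp: powr_diff)
    also have "\<dots> = c powr (\<Sum>i\<in>UNIV. - \<alpha> $ i)"
      using c by (simp add: powr_sum)
    finally show ?thesis
      by (simp add: sum_negf)
  qed
  ultimately have d: "ennreal (c ^ CARD('q)) * ?d (c *\<^sub>R r) = ennreal (c powr (- (\<Sum>i\<in>UNIV. \<alpha> $ i))) * ?d r" for r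
    using c by (simp add: ennreal_mult'[symmetric] mult.assoc[symmetric] prod_nonneg)
  have "(\<integral>\<^sup>+r. h r \<partial>theta \<alpha>) = (\<integral>\<^sup>+r. ?d r * h r \<partial>lborel)"
    using \<alpha> by (simp add: nn_integral_theta)
  also have "\<dots> = (\<integral>\<^sup>+r. ennreal (c ^ CARD('q)) * (?d (c *\<^sub>R r) * h (c *\<^sub>R r)) \<partial>lborel)"
    by (subst L, subst nn_integral_density, measurable, subst nn_integral_distr) auto
  also have "\<dots> = (\<integral>\<^sup>+r. ennreal (c powr (- (\<Sum>i\<in>UNIV. \<alpha> $ i))) * (?d r * h (c *\<^sub>R r)) \<partial>lborel)"
    using d by (simp only: mult.assoc[symmetric])
  also have "\<dots> = ennreal (c powr (- (\<Sum>i\<in>UNIV. \<alpha> $ i))) * (\<integral>\<^sup>+r. ?d r * h (c *\<^sub>R r) \<partial>lborel)"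
    by (intro nn_integral_cmult) measurable
  also have "(\<integral>\<^sup>+r. ?d r * h (c *\<^sub>R r) \<partial>lborel) = (\<integral>\<^sup>+r. h (c *\<^sub>R r) \<partial>theta \<alpha>)"
    using \<alpha> by (simp add: nn_integral_theta)
  finally show ?thesis .
qed

text \<open>The event is a product of one-dimensional tails, so its mass factorises. In the
  application \<open>p i\<close> is the supremum \<open>rho\<close> of the \<open>i\<close>-th
  component of the representer.\<close>

lemma theta_tail_le:
  fixes \<alpha> :: "real ^ 'q::finite"
  assumes \<alpha>: "\<alpha> \<in> pos_orthant" and c: "0 < c" and p: "\<And>i. 0 \<le> p i"
  shows "emeasure (theta \<alpha>) {r. \<forall>i. c < r $ i * p i} \<le> (\<Prod>i\<in>UNIV. ennreal ((p i / c) powr (\<alpha> $ i)))"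
proof -
  have [measurable]: "{x. c < x * p i} \<in> sets borel" for i
    by measurable
  have [measurable]: "{r :: real ^ 'q. \<forall>i. c < r $ i * p i} \<in> sets borel"
    by measurable
  have "emeasure (theta \<alpha>) {r. \<forall>i. c < r $ i * p i} = (\<integral>\<^sup>+r. indicator {r. \<forall>i. c < r $ i * p i} r \<partial>theta \<alpha>)"
    by simp
  also have "\<dots> = (\<integral>\<^sup>+r. (\<Prod>i\<in>UNIV. ennreal (pareto (\<alpha> $ i) (r $ i)))
      * indicator {r. \<forall>i. c < r $ i * p i} r \<partial>lborel)"
    using \<alpha> by (intro nn_integral_theta) auto
  also have "\<dots> = (\<integral>\<^sup>+r. (\<Prod>i\<in>UNIV. ennreal (pareto (\<alpha> $ i) (r $ i))
      * indicator {x. c < x * p i} (r $ i)) \<partial>lborel)"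
    by (intro nn_integral_cong) (auto simp: indicator_def prod_zero_iff)
  also have "\<dots> = (\<Prod>i\<in>UNIV. \<integral>\<^sup>+x. ennreal (pareto (\<alpha> $ i) x) * indicator {x. c < x * p i} x \<partial>lborel)"
    by (intro nn_integral_lborel_vec_prod) measurable
  also have "\<dots> \<le> (\<Prod>i\<in>UNIV. ennreal ((p i / c) powr (\<alpha> $ i)))"
    using \<alpha> c p by (intro prod_mono_ennreal pareto_tail_le) (auto simp: pos_orthant_nth)
  finally show ?thesis .
qed

lemma emeasure_theta_UNIV:
  fixes \<alpha> :: "real ^ 'q::finite"
  assumes \<alpha>: "\<alpha> \<in> pos_orthant"
  shows "emeasure (theta \<alpha>) UNIV \<noteq> 0"
proof -
  \<comment> \<open>The box with all coordinates at least 1 has mass exactly 1, each factor being a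
    tail from level 1.\<close>
  have "1 = (\<Prod>i\<in>(UNIV::'q set). \<integral>\<^sup>+x. ennreal (pareto (\<alpha> $ i) x) * indicator {1..} x \<partial>lborel)"
    using \<alpha> by (simp add: pareto_tail pos_orthant_nth)
  also have "\<dots> = (\<integral>\<^sup>+r. (\<Prod>i\<in>(UNIV::'q set). ennreal (pareto (\<alpha> $ i) (r $ i)) * indicator {1..} (r $ i)) \<partial>lborel)"
    by (intro nn_integral_lborel_vec_prod[symmetric]) measurable
  also have "\<dots> \<le> (\<integral>\<^sup>+r. (\<Prod>i\<in>UNIV. ennreal (pareto (\<alpha> $ i) (r $ i))) * 1 \<partial>lborel)"
    by (intro nn_integral_mono) (auto simp: indicator_def intro!: prod_mono_ennreal)
  also have "\<dots> = (\<integral>\<^sup>+r. 1 \<partial>theta \<alpha>)"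
    using \<alpha> by (intro nn_integral_theta[symmetric]) auto
  also have "\<dots> = emeasure (theta \<alpha>) UNIV"
    by (simp add: space_theta)
  finally show ?thesis
    by auto
qed

section \<open>Homogeneity and finiteness of the target measure\<close>

context
  fixes \<alpha> :: "real ^ 'q::finite" and N :: "'v measure" and Z :: "'v \<Rightarrow> ('t::topological_space, 'q) cfun"
  assumes \<alpha>: "\<alpha> \<in> pos_orthant" and N: "prob_space N" and Z [measurable]: "Z \<in> borel_measurable N"
begin

interpretation theta: sigma_finite_measure "theta \<alpha>"
  using \<alpha> by (rule sigma_finite_theta)

lemma measurable_scale_representer:
  "(\<lambda>(\<omega>, r). scale_cfun r (Z \<omega>)) \<in> N \<Otimes>\<^sub>M theta \<alpha> \<rightarrow>\<^sub>M borel"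
proof -
  have "(\<lambda>x. (snd x, Z (fst x))) \<in> N \<Otimes>\<^sub>M theta \<alpha> \<rightarrow>\<^sub>M borel \<Otimes>\<^sub>M borel"
    by measurable
  from measurable_compose[OF this measurable_scale_cfun_pair] show ?thesis
    by (simp add: case_prod_beta')
qed

text \<open>\<open>measure_of\<close> returns the prescribed set function only if that function is
  countably additive. Recognising it, by Tonelli, as an image of a product measure settles this and
  gives access to integration under image measures.\<close>

lemma nu_eq_distr: "nu \<alpha> N Z = distr (N \<Otimes>\<^sub>M theta \<alpha>) borel (\<lambda>(\<omega>, r). scale_cfun r (Z \<omega>))"
    (is "_ = ?D")
proof -
  have eq: "emeasure ?D A = (\<integral>\<^sup>+\<omega>. (\<integral>\<^sup>+r. indicator A (scale_cfun r (Z \<omega>)) \<partial>theta \<alpha>) \<partial>N)"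
    if A: "A \<in> sets borel" for A
  proof -
    have "emeasure ?D A = (\<integral>\<^sup>+f. indicator A f \<partial>?D)"
      using A by simp
    also have "\<dots> = (\<integral>\<^sup>+x. indicator A (case x of (\<omega>, r) \<Rightarrow> scale_cfun r (Z \<omega>)) \<partial>(N \<Otimes>\<^sub>M theta \<alpha>))"
      using A by (intro nn_integral_distr measurable_scale_representer) auto
    also have "\<dots> = (\<integral>\<^sup>+\<omega>. (\<integral>\<^sup>+r. indicator A (scale_cfun r (Z \<omega>)) \<partial>theta \<alpha>) \<partial>N)"
      using A measurable_compose[OF measurable_scale_representer, of "indicator A :: _ \<Rightarrow> ennreal"]
      by (subst theta.nn_integral_fst[symmetric]) auto
    finally show ?thesis .
  qed
  have "nu \<alpha> N Z = measure_of UNIV (sets borel) (emeasure ?D)"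
    unfolding nu_def using eq sets.sigma_sets_eq[of "borel :: ('t, 'q) cfun measure"]
    by (intro measure_of_eq) auto
  also have "\<dots> = ?D"
    using measure_of_of_measure[of ?D] by simp
  finally show ?thesis .
qed

lemma sets_nu: "sets (nu \<alpha> N Z) = sets borel"
  by (simp add: nu_eq_distr)

lemma nn_integral_nu:
  assumes "h \<in> borel_measurable borel"
  shows "(\<integral>\<^sup>+f. h f \<partial>nu \<alpha> N Z) = (\<integral>\<^sup>+\<omega>. (\<integral>\<^sup>+r. h (scale_cfun r (Z \<omega>)) \<partial>theta \<alpha>) \<partial>N)"
proof -
  have "(\<integral>\<^sup>+f. h f \<partial>nu \<alpha> N Z) = (\<integral>\<^sup>+x. h (case x of (\<omega>, r) \<Rightarrow> scale_cfun r (Z \<omega>)) \<partial>(N \<Otimes>\<^sub>M theta \<alpha>))"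
    unfolding nu_eq_distr using assms by (intro nn_integral_distr measurable_scale_representer) simp
  then show ?thesis
    using measurable_compose[OF measurable_scale_representer assms]
    by (simp add: theta.nn_integral_fst[symmetric])
qed

text \<open>Scaling the field by \<open>c\<close> after scaling it by \<open>r\<close> is scaling by
  \<open>c *\<^sub>R r\<close>, so the homogeneity of \<open>theta\<close> passes through the inner
  integral for every outcome of the representer.\<close>

lemma nu_scale:
  assumes c: "0 < c"
  shows "nu \<alpha> N Z = density (distr (nu \<alpha> N Z) borel (scale_cfun (vec c)))
     (\<lambda>_. ennreal (c powr (- (\<Sum>i\<in>UNIV. \<alpha> $ i))))" (is "_ = ?R")
proof (rule measure_eqI)
  show "sets (nu \<alpha> N Z) = sets ?R"
    by (simp add: sets_nu)
  fix A assume "A \<in> sets (nu \<alpha> N Z)"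
  then have A [measurable]: "A \<in> sets borel"
    by (simp add: sets_nu)
  note [measurable] = measurable_scale_cfun
  have sc: "scale_cfun (vec c) (scale_cfun r f) = scale_cfun (c *\<^sub>R r) f" for r f
    by (simp add: scale_cfun_scale_cfun scaleR_vec_def)
  let ?h = "\<lambda>\<omega> r. indicator A (scale_cfun r (Z \<omega>)) :: ennreal"
  have meas: "?h \<omega> \<in> borel_measurable borel" for \<omega>
  proof -
    have "(\<lambda>r. (r, Z \<omega>)) \<in> borel \<rightarrow>\<^sub>M borel \<Otimes>\<^sub>M borel"
      by measurable
    from measurable_compose[OF this measurable_scale_cfun_pair] show ?thesis
      by (intro borel_measurable_indicator') auto
  qed
  have meas2: "(\<lambda>\<omega>. \<integral>\<^sup>+r. indicator A (scale_cfun (vec c) (scale_cfun r (Z \<omega>))) \<partial>theta \<alpha>) \<in> borel_measurable N"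
  proof (rule theta.borel_measurable_nn_integral)
    show "(\<lambda>(\<omega>, r). indicator A (scale_cfun (vec c) (scale_cfun r (Z \<omega>))) :: ennreal)
        \<in> borel_measurable (N \<Otimes>\<^sub>M theta \<alpha>)"
      using measurable_compose[OF measurable_compose[OF measurable_scale_representer measurable_scale_cfun[of "vec c"]],
          of "indicator A :: _ \<Rightarrow> ennreal"]
      by (simp add: case_prod_beta')
  qed
  have "emeasure (nu \<alpha> N Z) A = (\<integral>\<^sup>+f. indicator A f \<partial>nu \<alpha> N Z)"
    by (simp add: sets_nu)
  also have "\<dots> = (\<integral>\<^sup>+\<omega>. (\<integral>\<^sup>+r. ?h \<omega> r \<partial>theta \<alpha>) \<partial>N)"
    by (rule nn_integral_nu) simp
  also have "\<dots> = (\<integral>\<^sup>+\<omega>. ennreal (c powr (- (\<Sum>i\<in>UNIV. \<alpha> $ i))) *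
      (\<integral>\<^sup>+r. indicator A (scale_cfun (vec c) (scale_cfun r (Z \<omega>))) \<partial>theta \<alpha>) \<partial>N)"
    unfolding sc using theta_scale[OF \<alpha> c meas] by simp
  also have "\<dots> = ennreal (c powr (- (\<Sum>i\<in>UNIV. \<alpha> $ i))) *
      (\<integral>\<^sup>+\<omega>. (\<integral>\<^sup>+r. indicator A (scale_cfun (vec c) (scale_cfun r (Z \<omega>))) \<partial>theta \<alpha>) \<partial>N)"
    using meas2 by (rule nn_integral_cmult)
  also have "(\<integral>\<^sup>+\<omega>. (\<integral>\<^sup>+r. indicator A (scale_cfun (vec c) (scale_cfun r (Z \<omega>))) \<partial>theta \<alpha>) \<partial>N)
      = (\<integral>\<^sup>+f. indicator A (scale_cfun (vec c) f) \<partial>nu \<alpha> N Z)"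
    by (rule nn_integral_nu[symmetric]) measurable
  also have "\<dots> = (\<integral>\<^sup>+f. indicator A f \<partial>distr (nu \<alpha> N Z) borel (scale_cfun (vec c)))"
    by (rule nn_integral_distr[symmetric]) (auto simp: measurable_scale_cfun cong: measurable_cong_sets[OF sets_nu refl])
  also have "ennreal (c powr (- (\<Sum>i\<in>UNIV. \<alpha> $ i))) * \<dots> = emeasure ?R A"
    by (subst emeasure_density) (simp_all add: nn_integral_cmult)
  finally show "emeasure (nu \<alpha> N Z) A = emeasure ?R A" .
qed

lemma integral_nu_scale:
  fixes g :: "('t, 'q) cfun \<Rightarrow> real"
  assumes c: "0 < c" and g: "g \<in> borel_measurable borel"
  shows "(\<integral>f. g f \<partial>nu \<alpha> N Z) = c powr (- (\<Sum>i\<in>UNIV. \<alpha> $ i)) * (\<integral>f. g (scale_cfun (vec c) f) \<partial>nu \<alpha> N Z)"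
proof -
  have m: "scale_cfun (vec c) \<in> nu \<alpha> N Z \<rightarrow>\<^sub>M borel"
    by (simp add: measurable_scale_cfun cong: measurable_cong_sets[OF sets_nu refl])
  show ?thesis
    using g by (subst nu_scale[OF c]) (simp add: integral_density integral_distr[OF m])
qed

lemma nu_nonzero: "emeasure (nu \<alpha> N Z) (space (nu \<alpha> N Z)) \<noteq> 0"
proof -
  interpret prob_space N by (rule N)
  have "emeasure (nu \<alpha> N Z) (space (nu \<alpha> N Z)) = (\<integral>\<^sup>+f. 1 \<partial>nu \<alpha> N Z)"
    by simp
  also have "\<dots> = emeasure (theta \<alpha>) UNIV"
    by (subst nn_integral_nu) (auto simp: emeasure_space_1 space_theta)
  finally show ?thesis
    using emeasure_theta_UNIV[OF \<alpha>] by simp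
qed

text \<open>For a fixed outcome the admissible \<open>r\<close> satisfy
  \<open>c < r $ i * rho K (n i) i (Z \<omega>)\<close> in every coordinate. The
  \<open>theta\<close>-mass of this region is at most a power of \<open>c\<close> times the product
  in the moment condition, whose expectation is finite.\<close>

lemma nu_finite_rho:
  assumes Kn: "\<And>i. compact (K (n i)) \<and> K (n i) \<noteq> {}"
    and moment: "(\<integral>\<^sup>+\<omega>. ennreal (\<Prod>i\<in>UNIV. rho K (n i) i (Z \<omega>) powr (\<alpha> $ i)) \<partial>N) < \<infinity>"
    and c: "0 < c"
  shows "emeasure (nu \<alpha> N Z) {f. \<forall>i. c < rho K (n i) i f} < \<infinity>"
proof -
  let ?A = "{f. \<forall>i. c < rho K (n i) i f} :: ('t, 'q) cfun set"
  have [measurable]: "rho K (n i) i \<in> borel_measurable borel" for i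
    using Kn by (intro borel_measurable_continuous_onI continuous_on_rho) auto
  have A: "?A \<in> sets borel"
    by measurable
  have rho0: "0 \<le> rho K (n i) i f" for i f
  proof -
    obtain t where "t \<in> K (n i)"
      using Kn by blast
    then have "\<bar>apply_cfun f t $ i\<bar> \<le> rho K (n i) i f"
      using Kn by (intro rho_upper) auto
    then show ?thesis
      by linarith
  qed
  have "emeasure (nu \<alpha> N Z) ?A = (\<integral>\<^sup>+f. indicator ?A f \<partial>nu \<alpha> N Z)"
    using A by (simp add: sets_nu)
  also have "\<dots> = (\<integral>\<^sup>+\<omega>. (\<integral>\<^sup>+r. indicator ?A (scale_cfun r (Z \<omega>)) \<partial>theta \<alpha>) \<partial>N)"
    using A by (intro nn_integral_nu) auto
  also have "\<dots> \<le> (\<integral>\<^sup>+\<omega>. ennreal (c powr (- (\<Sum>i\<in>UNIV. \<alpha> $ i))) *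
      ennreal (\<Prod>i\<in>UNIV. rho K (n i) i (Z \<omega>) powr (\<alpha> $ i)) \<partial>N)"
  proof (rule nn_integral_mono)
    fix \<omega>
    let ?p = "\<lambda>i. rho K (n i) i (Z \<omega>)"
    let ?B = "{r :: real ^ 'q. \<forall>i. c < r $ i * ?p i}"
    \<comment> \<open>Suprema scale linearly only for positive factors, hence the comparison holds
      almost everywhere for \<open>theta\<close>.\<close>
    have "(\<integral>\<^sup>+r. indicator ?A (scale_cfun r (Z \<omega>)) \<partial>theta \<alpha>) \<le> (\<integral>\<^sup>+r. indicator ?B r \<partial>theta \<alpha>)"
    proof (rule nn_integral_mono_AE)
      show "AE r in theta \<alpha>. indicator ?A (scale_cfun r (Z \<omega>)) \<le> (indicator ?B r :: ennreal)"
        using AE_theta_pos[OF \<alpha>]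
      proof eventually_elim
        case (elim r)
        then have "rho K (n i) i (scale_cfun r (Z \<omega>)) = r $ i * ?p i" for i
          using Kn by (intro rho_scale) (auto simp: pos_orthant_nth)
        then show ?case
          by (simp add: indicator_def)
      qed
    qed
    also have "\<dots> = emeasure (theta \<alpha>) ?B"
      by (intro nn_integral_indicator) (simp add: sets_theta, measurable)
    also have "\<dots> \<le> (\<Prod>i\<in>UNIV. ennreal ((?p i / c) powr (\<alpha> $ i)))"
      using \<alpha> c rho0 by (rule theta_tail_le)
    also have "\<dots> = ennreal (\<Prod>i\<in>UNIV. (?p i / c) powr (\<alpha> $ i))"
      by (intro prod_ennreal) auto
    also have "(\<Prod>i\<in>UNIV. (?p i / c) powr (\<alpha> $ i)) = (\<Prod>i\<in>UNIV. c powr (- \<alpha> $ i) * ?p i powr (\<alpha> $ i))"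
      using c rho0 by (intro prod.cong) (auto simp: powr_divide powr_minus field_simps)
    also have "\<dots> = c powr (- (\<Sum>i\<in>UNIV. \<alpha> $ i)) * (\<Prod>i\<in>UNIV. ?p i powr (\<alpha> $ i))"
      using c by (simp add: prod.distrib powr_sum sum_negf[symmetric])
    finally show "(\<integral>\<^sup>+r. indicator ?A (scale_cfun r (Z \<omega>)) \<partial>theta \<alpha>)
        \<le> ennreal (c powr (- (\<Sum>i\<in>UNIV. \<alpha> $ i))) * ennreal (\<Prod>i\<in>UNIV. ?p i powr (\<alpha> $ i))"
      by (simp add: ennreal_mult prod_nonneg)
  qed
  also have "\<dots> = ennreal (c powr (- (\<Sum>i\<in>UNIV. \<alpha> $ i))) *
      (\<integral>\<^sup>+\<omega>. ennreal (\<Prod>i\<in>UNIV. rho K (n i) i (Z \<omega>) powr (\<alpha> $ i)) \<partial>N)"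
    by (intro nn_integral_cmult) measurable
  also have "\<dots> < \<infinity>"
    using moment by (auto simp: ennreal_mult_less_top)
  finally show ?thesis .
qed

end

section \<open>Restricted measures\<close>

lemma sets_restrict_measure [simp]: "sets (restrict_measure A \<mu>) = sets \<mu>"
  by (simp add: restrict_measure_def)

lemma emeasure_restrict_measure:
  assumes "A \<in> sets \<mu>" "B \<in> sets \<mu>"
  shows "emeasure (restrict_measure A \<mu>) B = emeasure \<mu> (A \<inter> B)"
proof -
  have "emeasure (restrict_measure A \<mu>) B = (\<integral>\<^sup>+x. indicator A x * indicator B x \<partial>\<mu>)"
    unfolding restrict_measure_def using assms by (subst emeasure_density) simp_all
  also have "\<dots> = (\<integral>\<^sup>+x. indicator (A \<inter> B) x \<partial>\<mu>)"
    by (simp only: indicator_inter_arith)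
  finally have "emeasure (restrict_measure A \<mu>) B = (\<integral>\<^sup>+x. indicator (A \<inter> B) x \<partial>\<mu>)" .
  with assms show ?thesis
    by simp
qed

lemma integral_restrict_measure:
  fixes g :: "'a \<Rightarrow> real"
  assumes "A \<in> sets \<mu>" "g \<in> borel_measurable \<mu>"
  shows "(\<integral>x. g x \<partial>restrict_measure A \<mu>) = (\<integral>x. g x * indicator A x \<partial>\<mu>)"
proof -
  have "restrict_measure A \<mu> = density \<mu> (\<lambda>x. ennreal (indicator A x))"
    by (simp add: restrict_measure_def ennreal_indicator)
  then show ?thesis
    using assms by (simp add: integral_density mult.commute)
qed

lemma finite_measure_restrict_measure:
  assumes "A \<in> sets \<mu>" "emeasure \<mu> A < \<infinity>"
  shows "finite_measure (restrict_measure A \<mu>)"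
proof (rule finite_measureI)
  have "emeasure (restrict_measure A \<mu>) (space \<mu>) = emeasure \<mu> (A \<inter> space \<mu>)"
    using assms by (intro emeasure_restrict_measure) auto
  also have "A \<inter> space \<mu> = A"
    using assms sets.sets_into_space by auto
  finally show "emeasure (restrict_measure A \<mu>) (space (restrict_measure A \<mu>)) \<noteq> \<infinity>"
    using assms by (simp add: restrict_measure_def)
qed

section \<open>Thresholds and rates\<close>

lemma thresholds_at_top_iff:
  "filterlim f thresholds_at_top F \<longleftrightarrow> filterlim (\<lambda>x. MIN i. f x $ i) at_top F"
  by (simp add: thresholds_at_top_def filterlim_filtercomap_iff o_def)

lemma filterlim_component_thresholds: "filterlim (\<lambda>u. u $ i) at_top (thresholds_at_top :: (real ^ 'q::finite) filter)"
proof (rule filterlim_at_top_mono)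
  show "filterlim (\<lambda>u :: real ^ 'q. MIN i. u $ i) at_top thresholds_at_top"
    unfolding thresholds_at_top_def by (rule filterlim_filtercomap)
qed auto

lemma filterlim_scaleR_thresholds:
  assumes "0 < c"
  shows "filterlim (\<lambda>u. c *\<^sub>R u) thresholds_at_top (thresholds_at_top :: (real ^ 'q::finite) filter)"
  unfolding thresholds_at_top_iff
proof -
  have "filterlim (\<lambda>u :: real ^ 'q. c * (MIN i. u $ i)) at_top thresholds_at_top"
    using assms by (intro filterlim_tendsto_pos_mult_at_top[OF tendsto_const])
      (auto simp: thresholds_at_top_def intro: filterlim_filtercomap)
  then show "filterlim (\<lambda>u :: real ^ 'q. MIN i. (c *\<^sub>R u) $ i) at_top thresholds_at_top"
    using assms by (simp add: Min_mult_left_UNIV)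
qed

lemma eventually_pos_orthant_thresholds: "\<forall>\<^sub>F u in thresholds_at_top. u \<in> (pos_orthant :: (real ^ 'q::finite) set)"
proof -
  have "\<forall>\<^sub>F u in thresholds_at_top. 0 < (u :: real ^ 'q) $ i" for i
    using filterlim_component_thresholds by (rule filterlim_at_top_dense[THEN iffD1, rule_format])
  then have "\<forall>\<^sub>F u in thresholds_at_top. \<forall>i. 0 < (u :: real ^ 'q) $ i"
    by (rule eventually_all_finite)
  then show ?thesis
    by (simp add: pos_orthant_def)
qed

lemma rate_pos:
  assumes "\<And>i. regularly_varying (b i) (\<alpha> $ i)" "u \<in> pos_orthant"
  shows "0 < rate b u"
  using assms by (auto simp: rate_def regularly_varying_def pos_orthant_def intro!: prod_pos)

text \<open>The ratio factors over the coordinates, so each factor needs only its own threshold to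
  tend to infinity and relative rates do not matter. The limit is the factor that appears in
  \<open>nu_scale\<close>.\<close>

lemma rate_ratio_tendsto:
  fixes \<alpha> :: "real ^ 'q::finite"
  assumes b: "\<And>i. regularly_varying (b i) (\<alpha> $ i)" and c: "0 < c"
  shows "((\<lambda>u. rate b u / rate b (c *\<^sub>R u)) \<longlongrightarrow> c powr (- (\<Sum>i\<in>UNIV. \<alpha> $ i))) thresholds_at_top"
proof -
  have "((\<lambda>x. b i x / b i (c * x)) \<longlongrightarrow> c powr (- \<alpha> $ i)) at_top" for i
  proof -
    have "((\<lambda>x. inverse (b i (c * x) / b i x)) \<longlongrightarrow> inverse (c powr (\<alpha> $ i))) at_top"
      using b[of i] c by (intro tendsto_inverse) (auto simp: regularly_varying_def)
    then show ?thesis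
      by (simp add: powr_minus)
  qed
  from filterlim_compose[OF this filterlim_component_thresholds]
  have "((\<lambda>u. \<Prod>i\<in>UNIV. b i (u $ i) / b i (c * u $ i)) \<longlongrightarrow> (\<Prod>i\<in>UNIV. c powr (- \<alpha> $ i)))
      (thresholds_at_top :: (real ^ 'q) filter)"
    by (intro tendsto_prod)
  moreover have "(\<Prod>i\<in>UNIV. c powr (- \<alpha> $ i)) = c powr (- (\<Sum>i\<in>UNIV. \<alpha> $ i))"
    using c by (simp add: powr_sum sum_negf[symmetric])
  ultimately show ?thesis
    by (simp add: rate_def prod_dividef)
qed

section \<open>Exhaustions\<close>

lemma exhaustion_compact: "exhaustion K \<Longrightarrow> 1 \<le> n \<Longrightarrow> compact (K n) \<and> K n \<noteq> {}"
  by (simp add: exhaustion_def)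

lemma exhaustion_mono:
  assumes "exhaustion K" "1 \<le> m" "m \<le> n"
  shows "K m \<subseteq> K n"
  using assms(3,2)
proof (induction n rule: dec_induct)
  case (step n)
  then have "K n \<subseteq> K (Suc n)"
    using assms(1) by (simp add: exhaustion_def)
  with step show ?case
    by auto
qed simp

lemma rho_mono:
  assumes "exhaustion K" "1 \<le> m" "m \<le> n"
  shows "rho K m i f \<le> rho K n i f"
  unfolding rho_def using exhaustion_compact[OF assms(1)] exhaustion_mono[OF assms] assms
  by (intro cSUP_subset_mono bdd_above_rho) auto

lemma cube_eq_cbox: "(cube n :: (real ^ 'm::finite) set) = cbox (- vec (real n)) (vec (real n))"
  by (auto simp: cube_def mem_box_cart)

lemma exhaustion_cube: "exhaustion (cube :: nat \<Rightarrow> (real ^ 'm::finite) set)"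
  unfolding exhaustion_def
proof (intro conjI allI impI)
  fix n :: nat
  show "compact (cube n :: (real ^ 'm) set)"
    by (simp add: cube_eq_cbox)
  show "(cube n :: (real ^ 'm) set) \<noteq> {}"
    by (auto simp: cube_def intro!: exI[of _ 0])
  show "(cube n :: (real ^ 'm) set) \<subseteq> cube (Suc n)"
    by (rule subsetI, unfold cube_def mem_Collect_eq) (auto intro: order_trans[of _ "- real n"] order_trans[of _ "real n"])
next
  fix C :: "(real ^ 'm) set" assume "compact C"
  then obtain B where B: "\<And>x. x \<in> C \<Longrightarrow> norm x \<le> B"
    using bounded_iff[of C] compact_imp_bounded[of C] by metis
  define n where "n = Suc (nat \<lceil>B\<rceil>)"
  have n: "B \<le> real n"
    unfolding n_def by linarith
  have "x \<in> cube n" if "x \<in> C" for x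
  proof -
    have "\<bar>x $ j\<bar> \<le> real n" for j
      using component_le_norm_cart[of x j] B[OF that] n by linarith
    then show ?thesis
      by (auto simp: cube_def abs_le_iff minus_le_iff)
  qed
  then show "\<exists>n\<ge>1. C \<subseteq> cube n"
    by (intro exI[of _ n]) (auto simp: n_def)
qed

lemma countable_rat_points: "countable (rat_points :: (real ^ 'm::finite) set)"
proof -
  have "rat_points \<subseteq> (\<lambda>f. \<chi> j. f j) ` (PiE (UNIV :: 'm set) (\<lambda>_. \<rat>))"
  proof
    fix t :: "real ^ 'm" assume "t \<in> rat_points"
    then have "(\<lambda>j. t $ j) \<in> PiE UNIV (\<lambda>_. \<rat>)"
      by (auto simp: rat_points_def)
    then show "t \<in> (\<lambda>f. \<chi> j. f j) ` (PiE (UNIV :: 'm set) (\<lambda>_. \<rat>))"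
      by (intro image_eqI[of _ _ "\<lambda>j. t $ j"]) auto
  qed
  then show ?thesis
    by (rule countable_subset) (intro countable_image countable_PiE finite countable_rat)
qed

lemma rat_points_dense_cube:
  fixes t :: "real ^ 'm::finite"
  assumes t: "t \<in> cube n" and n: "1 \<le> n" and e: "0 < e"
  obtains s where "s \<in> rat_points" "s \<in> cube n" "dist s t < e"
proof -
  \<comment> \<open>The norm is at most the sum of \<open>CARD('m)\<close> coordinate errors, each
    bounded by \<open>d\<close>, which totals \<open>e / 2\<close>.\<close>
  define d where "d = e / (2 * real CARD('m))"
  have d: "0 < d"
    using e by (simp add: d_def)
  have "\<exists>x\<in>\<rat>. x \<in> {- real n..real n} \<and> \<bar>x - t $ j\<bar> \<le> d" for j
  proof -
    have tj: "- real n \<le> t $ j" "t $ j \<le> real n"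
      using t by (auto simp: cube_def)
    \<comment> \<open>The rational point has to stay inside the cube even if \<open>t\<close> is on
      its boundary. The two intervals overlap in a nondegenerate one because \<open>n\<close> is
      positive.\<close>
    have "max (- real n) (t $ j - d) < min (real n) (t $ j + d)"
      using tj d n by auto
    from Rats_dense_in_real[OF this] obtain x where
      "x \<in> \<rat>" "max (- real n) (t $ j - d) < x" "x < min (real n) (t $ j + d)"
      by blast
    then show ?thesis
      by (intro bexI[of _ x]) (auto simp: abs_le_iff)
  qed
  then obtain s where s: "\<And>j. s j \<in> \<rat>" "\<And>j. s j \<in> {- real n..real n}" "\<And>j. \<bar>s j - t $ j\<bar> \<le> d"
    by metis
  have "norm ((\<chi> j. s j) - t) \<le> (\<Sum>j\<in>UNIV. \<bar>((\<chi> j. s j) - t) $ j\<bar>)"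
    by (rule norm_le_l1_cart)
  also have "\<dots> \<le> (\<Sum>j\<in>(UNIV :: 'm set). d)"
    using s(3) by (intro sum_mono) simp
  also have "\<dots> < e"
    using e by (simp add: d_def)
  finally show ?thesis
    using s(1,2) by (intro that[of "\<chi> j. s j"]) (auto simp: rat_points_def cube_def dist_norm)
qed

text \<open>By continuity the strict inequality at one point of the cube persists on a ball, and
  this ball contains a rational point of the same cube.\<close>

lemma rat_points_dense_rho:
  fixes f :: "(real ^ 'm::finite, 'q::finite) cfun"
  assumes n: "1 \<le> n" and c: "c < rho cube n i f"
  shows "\<exists>t\<in>rat_points \<inter> cube n. c < \<bar>apply_cfun f t $ i\<bar>"
proof -
  obtain t where t: "t \<in> cube n" "c < \<bar>apply_cfun f t $ i\<bar>"
    using c less_rho_iff[of cube n c i f] exhaustion_compact[OF exhaustion_cube n] by blast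
  have "continuous_on UNIV (\<lambda>t. \<bar>apply_cfun f t $ i\<bar>)"
    by (intro continuous_intros continuous_on_apply_cfun)
  then have "open {t. c < \<bar>apply_cfun f t $ i\<bar>}"
    by (rule open_superlevel)
  then obtain e where e: "0 < e" "ball t e \<subseteq> {t. c < \<bar>apply_cfun f t $ i\<bar>}"
    using t(2) open_contains_ball by blast
  obtain s where "s \<in> rat_points" "s \<in> cube n" "dist s t < e"
    using rat_points_dense_cube[OF t(1) n e(1)] .
  with e show ?thesis
    by (intro bexI[of _ s]) (auto simp: dist_commute subset_iff)
qed

lemma finite_compact_discrete:
  fixes C :: "'d::discrete_topology set"
  assumes "compact C"
  shows "finite C"
proof -
  have "C \<subseteq> \<Union> ((\<lambda>x. {x}) ` C)" "\<And>B. B \<in> (\<lambda>x. {x}) ` C \<Longrightarrow> open B"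
    by (auto intro: discrete_topology_class.open_discrete)
  then obtain D where D: "D \<subseteq> (\<lambda>x. {x}) ` C" "finite D" "C \<subseteq> \<Union>D"
    by (rule compactE[OF assms])
  have "finite (\<Union>D)"
    using D(1,2) by (intro finite_Union) auto
  with D(3) show ?thesis
    by (rule finite_subset)
qed

section \<open>The normalised laws\<close>

lemma finite_measure_mu:
  assumes "prob_space M" "X \<in> borel_measurable M"
  shows "finite_measure (mu b M X u)"
proof -
  interpret prob_space M by fact
  let ?Y = "\<lambda>\<omega>. scale_cfun (vec_inverse u) (X \<omega>)"
  have Y: "?Y \<in> borel_measurable M"
    using assms(2) measurable_scale_cfun by (rule measurable_compose)
  interpret Y: prob_space "distr M borel ?Y"
    using Y by (rule prob_space_distr)
  show ?thesis
    unfolding mu_def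
    by (rule finite_measure_restrict_measure)
      (auto simp: open_nonzero_fields ennreal_mult_less_top Y.emeasure_eq_measure)
qed

lemma sets_mu: "sets (mu b M X u) = sets borel"
  by (simp add: mu_def)

lemma integral_mu:
  fixes g :: "('t::topological_space, 'q::finite) cfun \<Rightarrow> real"
  assumes X: "X \<in> borel_measurable M" and g: "g \<in> borel_measurable borel" and r: "0 \<le> rate b u"
  shows "(\<integral>f. g f \<partial>mu b M X u) = rate b u *
     (\<integral>\<omega>. g (scale_cfun (vec_inverse u) (X \<omega>)) * indicator nonzero_fields (scale_cfun (vec_inverse u) (X \<omega>)) \<partial>M)"
proof -
  let ?Y = "\<lambda>\<omega>. scale_cfun (vec_inverse u) (X \<omega>)"
  let ?D = "distr M borel ?Y" and ?nz = "nonzero_fields :: ('t, 'q) cfun set"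
  have Y: "?Y \<in> borel_measurable M"
    using X measurable_scale_cfun by (rule measurable_compose)
  have nz [measurable]: "?nz \<in> sets borel"
    using open_nonzero_fields by (rule borel_open)
  have sc: "scale_measure (ennreal (rate b u)) ?D = density ?D (\<lambda>_. ennreal (rate b u))"
    by (rule measure_eqI) (simp_all add: emeasure_density nn_integral_cmult)
  have "(\<integral>f. g f \<partial>mu b M X u) = (\<integral>f. g f * indicator ?nz f \<partial>scale_measure (ennreal (rate b u)) ?D)"
    unfolding mu_def using g by (intro integral_restrict_measure) auto
  also have "\<dots> = rate b u * (\<integral>f. g f * indicator ?nz f \<partial>?D)"
    unfolding sc using g r by (subst integral_density) auto
  also have "(\<integral>f. g f * indicator ?nz f \<partial>?D) = (\<integral>\<omega>. g (?Y \<omega>) * indicator ?nz (?Y \<omega>) \<partial>M)"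
    using g by (intro integral_distr Y) auto
  finally show ?thesis .
qed

text \<open>Dividing \<open>X\<close> by \<open>u\<close> is the same as dividing it by
  \<open>c *\<^sub>R u\<close> and then multiplying by \<open>c\<close>. Thus both sides involve the
  same random field and differ only in the normalising rate.\<close>

lemma mu_scale:
  fixes g :: "('t::topological_space, 'q::finite) cfun \<Rightarrow> real"
  assumes b: "\<And>i. regularly_varying (b i) (\<alpha> $ i)"
    and X: "X \<in> borel_measurable M" and g: "g \<in> borel_measurable borel"
    and u: "u \<in> pos_orthant" and c: "0 < c"
  shows "(\<integral>f. g f \<partial>mu b M X u) = rate b u / rate b (c *\<^sub>R u) *
     (\<integral>f. g (scale_cfun (vec c) f) \<partial>mu b M X (c *\<^sub>R u))"
proof -
  have cu: "c *\<^sub>R u \<in> pos_orthant"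
    using u c by (simp add: pos_orthant_def)
  have r: "0 < rate b u" "0 < rate b (c *\<^sub>R u)"
    using b u cu by (auto intro: rate_pos)
  have sc: "scale_cfun (vec c) (scale_cfun (vec_inverse (c *\<^sub>R u)) f) = scale_cfun (vec_inverse u) f"
    for f :: "('t, 'q) cfun"
    using c by (simp add: scale_cfun_scale_cfun vec_inverse_def mult.assoc[symmetric])
  have nz: "scale_cfun (vec_inverse v) f \<in> nonzero_fields \<longleftrightarrow> f \<in> nonzero_fields"
    if "v \<in> pos_orthant" for v and f :: "('t, 'q) cfun"
    using that by (intro nonzero_fields_scale) (auto simp: vec_inverse_def pos_orthant_def less_le)
  have "(\<lambda>f. g (scale_cfun (vec c) f)) \<in> borel_measurable borel"
    using measurable_scale_cfun g by (rule measurable_compose)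
  then show ?thesis
    using r X g u cu by (simp add: integral_mu sc nz indicator_def)
qed

section \<open>Regular variation and anchored convergence\<close>

locale field_representer =
  fixes \<alpha> :: "real ^ 'q::finite" and b :: "'q \<Rightarrow> real \<Rightarrow> real"
    and M :: "'w measure" and N :: "'v measure"
    and K :: "nat \<Rightarrow> 't::topological_space set"
    and X :: "'w \<Rightarrow> ('t, 'q) cfun" and Z :: "'v \<Rightarrow> ('t, 'q) cfun"
  assumes \<alpha>: "\<alpha> \<in> pos_orthant" and b: "\<And>i. regularly_varying (b i) (\<alpha> $ i)"
    and prob_M: "prob_space M" and prob_N: "prob_space N"
    and K: "exhaustion K" and X: "X \<in> borel_measurable M" and Z: "representer K \<alpha> N Z"
begin

abbreviation "\<nu> \<equiv> nu \<alpha> N Z"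
abbreviation "\<mu> \<equiv> mu b M X"
abbreviation "\<sigma> \<equiv> \<Sum>i\<in>UNIV. \<alpha> $ i"

lemma Z_measurable: "Z \<in> borel_measurable N"
  using Z by (simp add: representer_def)

sublocale borel_measure_net \<mu> \<nu> thresholds_at_top
  by (rule borel_measure_net.intro)
    (rule finite_measure_mu[OF prob_M X] sets_mu sets_nu[OF \<alpha> prob_N Z_measurable])+

section \<open>Finite masses and change of level\<close>

lemma nu_finite_levels:
  assumes "\<And>i. 1 \<le> n i" "0 < c"
  shows "emeasure \<nu> {f. \<forall>i. c < rho K (n i) i f} < \<infinity>"
  using assms Z exhaustion_compact[OF K]
  by (intro nu_finite_rho \<alpha> prob_N Z_measurable) (auto simp: representer_def)

lemma joint_superlevel_eq: "{f. c < joint_level K n f} = {f. \<forall>i. c < rho K n i f}"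
  by (simp add: joint_level_def less_Min_UNIV_iff)

lemma nu_finite_joint: "1 \<le> n \<Longrightarrow> 0 < c \<Longrightarrow> emeasure \<nu> {f. c < joint_level K n f} < \<infinity>"
  unfolding joint_superlevel_eq by (rule nu_finite_levels)

lemma continuous_joint: "1 \<le> n \<Longrightarrow> continuous_on UNIV (joint_level K n)"
  using exhaustion_compact[OF K] by (intro continuous_on_joint_level) auto

text \<open>A single point is compact and so lies in some set of the exhaustion. Hence an anchored
  set is contained in a product window, in general with a different index for each
  coordinate.\<close>

lemma anchors_in_level:
  "\<exists>n. \<forall>i. 1 \<le> n i \<and> (\<forall>f :: ('t, 'q) cfun. \<bar>apply_cfun f (h i) $ i\<bar> \<le> rho K (n i) i f)"
proof (rule choice, rule allI)
  fix i
  have "compact {h i}"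
    by simp
  then obtain n where n: "1 \<le> n" "h i \<in> K n"
    using K unfolding exhaustion_def by blast
  then show "\<exists>n. 1 \<le> n \<and> (\<forall>f :: ('t, 'q) cfun. \<bar>apply_cfun f (h i) $ i\<bar> \<le> rho K n i f)"
    using exhaustion_compact[OF K n(1)] by (auto intro!: rho_upper)
qed

lemma nu_finite_anchor:
  assumes "0 < c"
  shows "emeasure \<nu> {f. c < anchor_level h f} < \<infinity>"
proof -
  obtain n where "\<forall>i. 1 \<le> n i \<and> (\<forall>f :: ('t, 'q) cfun. \<bar>apply_cfun f (h i) $ i\<bar> \<le> rho K (n i) i f)"
    using anchors_in_level by blast
  then have n: "\<And>i. 1 \<le> n i"
    "\<And>i f. \<bar>apply_cfun (f :: ('t, 'q) cfun) (h i) $ i\<bar> \<le> rho K (n i) i f"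
    by auto
  have "emeasure \<nu> {f. c < anchor_level h f} \<le> emeasure \<nu> {f. \<forall>i. c < rho K (n i) i f}"
  proof (rule emeasure_mono)
    show "{f. c < anchor_level h f} \<subseteq> {f. \<forall>i. c < rho K (n i) i f}"
      using n(2) by (auto simp: anchor_level_def less_Min_UNIV_iff intro: less_le_trans)
    have "open (\<Inter>i. {f. c < rho K (n i) i f})"
      using n(1) exhaustion_compact[OF K] by (intro open_INT ballI open_superlevel continuous_on_rho) auto
    then show "{f. \<forall>i. c < rho K (n i) i f} \<in> sets \<nu>"
      by (intro open_in_sets) (simp add: Collect_all_eq)
  qed
  also have "\<dots> < \<infinity>"
    using n(1) assms by (rule nu_finite_levels)
  finally show ?thesis .
qed

lemma conv_windowed:
  assumes RV: "RV_Pi K \<alpha> \<nu> b M X" and g: "bdd_continuous g"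
    and n: "\<And>i. 1 \<le> n i" and c: "0 < c"
    and vanish: "\<And>f. \<not> (\<forall>i. c < rho K (n i) i f) \<Longrightarrow> g f = 0"
  shows "conv g"
proof -
  have "g \<in> test_functions K"
    unfolding test_functions_def
  proof (intro CollectI conjI exI[of _ n] exI[of _ "vec c"] allI impI)
    show "vec c \<in> pos_orthant"
      using c by (simp add: pos_orthant_def)
    show "g f = 0" if "f \<notin> window K n (vec c)" for f
      using that by (intro vanish) (simp add: window_def)
  qed (use g n in \<open>auto simp: bdd_continuous_def\<close>)
  with RV show ?thesis
    by (simp add: RV_Pi_def conv_def)
qed

text \<open>Homogeneity turns the mass into a constant times a power of the level. Continuity in the
  level is the form in which the later arguments use that the boundary carries no
  \<nu>-mass.\<close>

lemma isCont_nu_superlevel: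
  assumes q: "continuous_on UNIV q" "\<And>c f. 0 < c \<Longrightarrow> q (scale_cfun (vec c) f) = c * q f"
    and c: "0 < c"
  shows "isCont (\<lambda>c. measure \<nu> {f. c < q f}) c"
proof -
  have op: "open {f. c < q f}" for c
    using q(1) by (rule open_superlevel)
  have eq: "measure \<nu> {f. c < q f} = c powr (- \<sigma>) * measure \<nu> {f. 1 < q f}" if c: "0 < c" for c
  proof -
    have "measure \<nu> {f. c < q f} = (\<integral>f. indicator {f. c < q f} f \<partial>\<nu>)"
      by (simp add: open_in_sets op)
    also have "\<dots> = c powr (- \<sigma>) * (\<integral>f. indicator {f. c < q f} (scale_cfun (vec c) f) \<partial>\<nu>)"
      using c op by (intro integral_nu_scale \<alpha> prob_N Z_measurable borel_measurable_indicator_open)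
    also have "(\<lambda>f. indicator {f. c < q f} (scale_cfun (vec c) f) :: real) = indicator {f. 1 < q f}"
      using c q(2) by (auto simp: indicator_def)
    finally show ?thesis
      by (simp add: open_in_sets op)
  qed
  have "isCont (\<lambda>c. c powr (- \<sigma>) * measure \<nu> {f. 1 < q f}) c"
    using c by (intro continuous_intros) auto
  moreover have "\<forall>\<^sub>F x in nhds c. measure \<nu> {f. x < q f} = x powr (- \<sigma>) * measure \<nu> {f. 1 < q f}"
    using eventually_nhds_in_open[of "{0<..}" c] c by (auto elim!: eventually_mono intro: eq)
  ultimately show ?thesis
    by (subst isCont_cong) auto
qed

lemma isCont_joint:
  assumes "1 \<le> n" "0 < c"
  shows "isCont (\<lambda>c. measure \<nu> {f. c < joint_level K n f}) c"
  using assms exhaustion_compact[OF K assms(1)]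
  by (intro isCont_nu_superlevel continuous_joint joint_level_scale) auto

text \<open>By \<open>mu_scale\<close>, the integral over level \<open>c\<close> at threshold
  \<open>u\<close> is a rate ratio times an integral over level 1 at threshold
  \<open>c *\<^sub>R u\<close>. The thresholds \<open>c *\<^sub>R u\<close> again tend to infinity,
  and the limit of the ratio matches the factor in \<open>integral_nu_scale\<close>.\<close>

lemma conv_on_rescale:
  assumes q: "continuous_on UNIV q" "\<And>c f. 0 < c \<Longrightarrow> q (scale_cfun (vec c) f) = c * q f"
    and conv1: "conv_on {f. 1 < q f}" and c: "0 < c"
  shows "conv_on {f. c < q f}"
  unfolding conv_on_def
proof (intro allI impI)
  fix g :: "('t, 'q) cfun \<Rightarrow> real" assume g: "bdd_continuous g"
  let ?gc = "\<lambda>f. g (scale_cfun (vec c) f)"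
  have op: "open {f. c < q f}" for c
    using q(1) by (rule open_superlevel)
  have "continuous_on UNIV ?gc"
    using g continuous_on_compose2[OF _ continuous_on_scale_cfun, of UNIV g]
    by (auto simp: bdd_continuous_def)
  moreover obtain B where "0 \<le> B" "\<And>f. \<bar>g f\<bar> \<le> B"
    using g by (meson bdd_continuousE)
  ultimately have "bdd_continuous ?gc"
    by (intro bdd_continuousI) auto
  with conv1 have "((\<lambda>u. \<integral>f. ?gc f * indicator {f. 1 < q f} f \<partial>\<mu> u)
      \<longlongrightarrow> (\<integral>f. ?gc f * indicator {f. 1 < q f} f \<partial>\<nu>)) thresholds_at_top"
    by (simp add: conv_on_def conv_def)
  from filterlim_compose[OF this filterlim_scaleR_thresholds[OF c]]
  have "((\<lambda>u. rate b u / rate b (c *\<^sub>R u) * (\<integral>f. ?gc f * indicator {f. 1 < q f} f \<partial>\<mu> (c *\<^sub>R u)))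
      \<longlongrightarrow> c powr (- \<sigma>) * (\<integral>f. ?gc f * indicator {f. 1 < q f} f \<partial>\<nu>)) thresholds_at_top"
    by (intro tendsto_mult rate_ratio_tendsto b c)
  moreover have meas: "(\<lambda>f. g f * indicator {f. c < q f} f) \<in> borel_measurable borel"
    using g op by (intro borel_measurable_times borel_measurable_indicator_open)
      (auto simp: bdd_continuous_def intro: borel_measurable_continuous_onI)
  have ind: "indicator {f. c < q f} (scale_cfun (vec c) f) = (indicator {f. 1 < q f} f :: real)" for f
    using c q(2) by (simp add: indicator_def)
  have "\<forall>\<^sub>F u in thresholds_at_top. rate b u / rate b (c *\<^sub>R u) *
      (\<integral>f. ?gc f * indicator {f. 1 < q f} f \<partial>\<mu> (c *\<^sub>R u)) = (\<integral>f. g f * indicator {f. c < q f} f \<partial>\<mu> u)"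
    using eventually_pos_orthant_thresholds
  proof eventually_elim
    case (elim u)
    show ?case
      using mu_scale[OF b X meas elim c] by (simp add: ind)
  qed
  moreover have "c powr (- \<sigma>) * (\<integral>f. ?gc f * indicator {f. 1 < q f} f \<partial>\<nu>) = (\<integral>f. g f * indicator {f. c < q f} f \<partial>\<nu>)"
    using integral_nu_scale[OF \<alpha> prob_N Z_measurable c meas] by (simp add: ind)
  ultimately show "conv (\<lambda>f. g f * indicator {f. c < q f} f)"
    unfolding conv_def by (auto dest: Lim_transform_eventually)
qed

lemma anchor_convergence_iff:
  "anchor_convergence D \<mu> \<nu> \<longleftrightarrow> (\<forall>h. (\<forall>i. h i \<in> D) \<longrightarrow> conv_on {f. 1 < anchor_level h f})"
proof -
  have "weak_conv_finite (\<lambda>u. restrict_measure (anchor_set h) (\<mu> u)) (restrict_measure (anchor_set h) \<nu>)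
      thresholds_at_top \<longleftrightarrow> conv_on {f. 1 < anchor_level h f}" for h
  proof -
    have op: "open {f. 1 < anchor_level h f}"
      by (intro open_superlevel continuous_on_anchor_level)
    have "finite_measure (restrict_measure (anchor_set h) \<nu>)"
      unfolding anchor_set_eq using op by (intro finite_measure_restrict_measure open_in_sets nu_finite_anchor) auto
    moreover have "finite_measure (restrict_measure (anchor_set h) (\<mu> u))" for u
      unfolding anchor_set_eq using op
      by (intro finite_measure_restrict_measure open_in_sets)
        (auto simp: finite_measure.emeasure_finite[OF finite_net] less_top[symmetric])
    moreover have "(\<integral>f. g f \<partial>restrict_measure (anchor_set h) (\<mu> u)) = (\<integral>f. g f * indicator {f. 1 < anchor_level h f} f \<partial>\<mu> u)"
      "(\<integral>f. g f \<partial>restrict_measure (anchor_set h) \<nu>) = (\<integral>f. g f * indicator {f. 1 < anchor_level h f} f \<partial>\<nu>)"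
      if "continuous_on UNIV g" for g :: "('t, 'q) cfun \<Rightarrow> real" and u
      unfolding anchor_set_eq using op that
      by (auto intro!: integral_restrict_measure open_in_sets measurable_net borel_measurable_continuous_onI)
    ultimately show ?thesis
      unfolding weak_conv_finite_def conv_on_def conv_def bdd_continuous_def by auto
  qed
  then show ?thesis
    by (simp add: anchor_convergence_def)
qed

text \<open>All masses involved are finite, so the extended-valued limit superior can be replaced by
  an inequality with slack \<open>e\<close> between reals.\<close>

lemma limsup_joint_iff:
  assumes n: "1 \<le> n"
  shows "Limsup thresholds_at_top (\<lambda>u. emeasure (\<mu> u) (joint_set K n)) \<le> emeasure \<nu> (joint_set K n) \<longleftrightarrow>
    (\<forall>e>0. \<forall>\<^sub>F u in thresholds_at_top. measure (\<mu> u) {f. 1 / real n < joint_level K n f}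
        < measure \<nu> {f. 1 / real n < joint_level K n f} + e)"
    (is "?L \<longleftrightarrow> ?R")
proof -
  let ?W = "{f. 1 / real n < joint_level K n f}"
  have \<nu>: "emeasure \<nu> ?W = ennreal (measure \<nu> ?W)"
    using nu_finite_joint[OF n, of "1 / real n"] n by (intro emeasure_eq_ennreal_measure) auto
  have \<mu>: "emeasure (\<mu> u) ?W = ennreal (measure (\<mu> u) ?W)" for u
    by (intro finite_measure.emeasure_eq_measure finite_net)
  have L: "?L \<longleftrightarrow> (\<forall>y>ennreal (measure \<nu> ?W). \<forall>\<^sub>F u in thresholds_at_top. ennreal (measure (\<mu> u) ?W) < y)"
    unfolding joint_set_eq \<mu> \<nu> Limsup_le_iff ..
  show ?thesis
  proof
    assume ?L
    show ?R
    proof (intro allI impI)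
      fix e :: real assume "0 < e"
      then have "ennreal (measure \<nu> ?W) < ennreal (measure \<nu> ?W + e)"
        by (simp add: ennreal_less_iff)
      with \<open>?L\<close> have "\<forall>\<^sub>F u in thresholds_at_top. ennreal (measure (\<mu> u) ?W) < ennreal (measure \<nu> ?W + e)"
        unfolding L by blast
      then show "\<forall>\<^sub>F u in thresholds_at_top. measure (\<mu> u) ?W < measure \<nu> ?W + e"
        by (simp add: ennreal_less_iff)
    qed
  next
    assume R: ?R
    show ?L
      unfolding L
    proof (intro allI impI)
      fix y assume y: "ennreal (measure \<nu> ?W) < y"
      \<comment> \<open>The bound \<open>y\<close> may be infinite; a real \<open>z\<close> strictly
        below it supplies a finite slack.\<close>
      then obtain z where z: "ennreal (measure \<nu> ?W) < ennreal z" "ennreal z < y" "0 \<le> z"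
        using dense[OF y] by (metis ennreal_cases less_top_ennreal order.strict_trans top.not_eq_extremum)
      then have "0 < z - measure \<nu> ?W"
        by (simp add: ennreal_less_iff)
      with R have "\<forall>\<^sub>F u in thresholds_at_top. measure (\<mu> u) ?W < measure \<nu> ?W + (z - measure \<nu> ?W)"
        by blast
      then show "\<forall>\<^sub>F u in thresholds_at_top. ennreal (measure (\<mu> u) ?W) < y"
      proof eventually_elim
        case (elim u)
        then have "ennreal (measure (\<mu> u) ?W) \<le> ennreal z"
          by (intro ennreal_leI) simp
        also note z(2)
        finally show ?case .
      qed
    qed
  qed
qed

lemma limsup_joint_rescale:
  assumes n: "1 \<le> n" and d: "0 < d" and c: "0 < c" and e: "0 < e"
    and upper: "\<And>e. 0 < e \<Longrightarrow> \<forall>\<^sub>F u in thresholds_at_top.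
      measure (\<mu> u) {f. d < joint_level K n f} < measure \<nu> {f. d < joint_level K n f} + e"
  shows "\<forall>\<^sub>F u in thresholds_at_top.
      measure (\<mu> u) {f. c < joint_level K n f} < measure \<nu> {f. c < joint_level K n f} + e"
proof -
  \<comment> \<open>Scaling by \<open>s\<close> carries level \<open>d\<close> to level
    \<open>c\<close>.\<close>
  define s where "s = c / d"
  have s: "0 < s" "s * d = c"
    using c d by (auto simp: s_def)
  have op: "open {f. c < joint_level K n f}" for c
    by (intro open_superlevel continuous_joint n)
  let ?m = "\<lambda>c. measure \<nu> {f. c < joint_level K n f}"
  let ?r = "\<lambda>u. rate b u / rate b (s *\<^sub>R u)"
  have ind: "indicator {f. c < joint_level K n f} (scale_cfun (vec s) f)
      = (indicator {f. d < joint_level K n f} f :: real)" for f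
    using s exhaustion_compact[OF K n] mult_less_cancel_left_pos[of s d "joint_level K n f"]
    by (simp add: indicator_def joint_level_scale)
  have mc: "?m c = s powr (- \<sigma>) * ?m d"
    using integral_nu_scale[OF \<alpha> prob_N Z_measurable s(1) borel_measurable_indicator_open[OF op[of c]]]
    by (simp add: ind open_in_sets op)
  have mu: "measure (\<mu> u) {f. c < joint_level K n f} = ?r u * measure (\<mu> (s *\<^sub>R u)) {f. d < joint_level K n f}"
    if "u \<in> pos_orthant" for u
    using mu_scale[OF b X borel_measurable_indicator_open[OF op[of c]] that s(1)]
    by (simp add: ind open_in_sets op)
  \<comment> \<open>After multiplication by the limiting ratio this slack becomes
    \<open>e / 2\<close>, which leaves room for the ratio itself to converge.\<close>
  define e' where "e' = e / (2 * s powr (- \<sigma>))"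
  have e': "0 < e'" "s powr (- \<sigma>) * e' = e / 2"
    using e s by (auto simp: e'_def)
  have "((\<lambda>u. ?r u * (?m d + e')) \<longlongrightarrow> s powr (- \<sigma>) * (?m d + e')) thresholds_at_top"
    by (intro tendsto_mult tendsto_const rate_ratio_tendsto b s)
  moreover have "s powr (- \<sigma>) * (?m d + e') < ?m c + e"
    using e' e by (simp add: mc distrib_left)
  ultimately have "\<forall>\<^sub>F u in thresholds_at_top. ?r u * (?m d + e') < ?m c + e"
    by (rule order_tendstoD(2))
  moreover have "\<forall>\<^sub>F u in thresholds_at_top. measure (\<mu> (s *\<^sub>R u)) {f. d < joint_level K n f} < ?m d + e'"
    using filterlim_scaleR_thresholds[OF s(1)] upper[OF e'(1)]
    by (auto simp: filterlim_iff)
  ultimately show ?thesis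
    using eventually_pos_orthant_thresholds
  proof eventually_elim
    case (elim u)
    have "s *\<^sub>R u \<in> pos_orthant"
      using elim s by (simp add: pos_orthant_def)
    then have "0 \<le> ?r u"
      using rate_pos[of b, OF b] elim by (simp add: less_imp_le)
    then have "?r u * measure (\<mu> (s *\<^sub>R u)) {f. d < joint_level K n f} \<le> ?r u * (?m d + e')"
      using elim by (intro mult_left_mono) auto
    with elim show ?case
      by (simp add: mu)
  qed
qed

section \<open>From windows to anchored sets and back\<close>

lemma joint_level_cover:
  assumes n: "1 \<le> n" and dense: "\<And>(f :: ('t, 'q) cfun) i c. c < rho K n i f \<Longrightarrow> \<exists>t\<in>D \<inter> K n. c < \<bar>apply_cfun f t $ i\<bar>"
  shows "{f :: ('t, 'q) cfun. c < joint_level K n f} = (\<Union>h\<in>PiE UNIV (\<lambda>_. D \<inter> K n). {f. c < anchor_level h f})"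
proof (intro set_eqI iffI)
  fix f :: "('t, 'q) cfun" assume "f \<in> {f. c < joint_level K n f}"
  \<comment> \<open>The minimum exceeds \<open>c\<close> exactly if every coordinate does, so each
    coordinate may choose its own point; this is why anchors are tuples.\<close>
  then have "\<exists>t\<in>D \<inter> K n. c < \<bar>apply_cfun f t $ i\<bar>" for i
    by (intro dense) (simp add: joint_level_def less_Min_UNIV_iff)
  then obtain h where "\<And>i. h i \<in> D \<inter> K n" "\<And>i. c < \<bar>apply_cfun f (h i) $ i\<bar>"
    by metis
  then show "f \<in> (\<Union>h\<in>PiE UNIV (\<lambda>_. D \<inter> K n). {f. c < anchor_level h f})"
    by (auto simp: anchor_level_def less_Min_UNIV_iff intro!: bexI[of _ h])
next
  fix f :: "('t, 'q) cfun" assume "f \<in> (\<Union>h\<in>PiE UNIV (\<lambda>_. D \<inter> K n). {f. c < anchor_level h f})"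
  then obtain h where h: "\<And>i. h i \<in> K n" "\<And>i. c < \<bar>apply_cfun f (h i) $ i\<bar>"
    by (auto simp: anchor_level_def less_Min_UNIV_iff PiE_iff)
  have "c < rho K n i f" for i
    using h(2)[of i] rho_upper[of K n "h i" f i] h(1)[of i] exhaustion_compact[OF K n] by auto
  then show "f \<in> {f. c < joint_level K n f}"
    by (simp add: joint_level_def less_Min_UNIV_iff)
qed

text \<open>A bounded continuous function supported at a positive level of
  \<open>anchor_level h\<close> is a test function, because evaluations are dominated by suprema.
  Hence \<open>conv_on_superlevel\<close> applies at level 1.\<close>

lemma anchor_convergence_of_RV_Pi:
  assumes RV: "RV_Pi K \<alpha> \<nu> b M X"
  shows "anchor_convergence D \<mu> \<nu>"
  unfolding anchor_convergence_iff
proof (intro allI impI)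
  fix h :: "'q \<Rightarrow> 't"
  obtain n where "\<forall>i. 1 \<le> n i \<and> (\<forall>f :: ('t, 'q) cfun. \<bar>apply_cfun f (h i) $ i\<bar> \<le> rho K (n i) i f)"
    using anchors_in_level by blast
  then have n: "\<And>i. 1 \<le> n i"
    "\<And>i f. \<bar>apply_cfun (f :: ('t, 'q) cfun) (h i) $ i\<bar> \<le> rho K (n i) i f"
    by auto
  show "conv_on {f. 1 < anchor_level h f}"
  proof (rule conv_on_superlevel[OF continuous_on_anchor_level])
    fix g :: "('t, 'q) cfun \<Rightarrow> real" and c :: real
    assume c: "0 < c" and g: "bdd_continuous g" and vanish: "\<And>f. \<not> c < anchor_level h f \<Longrightarrow> g f = 0"
    show "conv g"
    proof (rule conv_windowed[OF RV g n(1) c])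
      fix f :: "('t, 'q) cfun" assume "\<not> (\<forall>i. c < rho K (n i) i f)"
      then obtain i where "\<not> c < rho K (n i) i f"
        by blast
      with n(2)[of f i] have "\<not> c < \<bar>apply_cfun f (h i) $ i\<bar>"
        by linarith
      then show "g f = 0"
        by (intro vanish) (auto simp: anchor_level_def less_Min_UNIV_iff)
    qed
  next
    show "emeasure \<nu> {f. c < anchor_level h f} < \<infinity>" if "0 < c" for c
      using that by (rule nu_finite_anchor)
    show "isCont (\<lambda>c. measure \<nu> {f. c < anchor_level h f}) 1"
      by (intro isCont_nu_superlevel continuous_on_anchor_level anchor_level_scale) auto
  qed simp
qed

text \<open>Testing the restricted convergence with the constant 1 even gives convergence of the
  masses, of which only the upper half is kept.\<close>

lemma limsup_joint_of_RV_Pi: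
  assumes RV: "RV_Pi K \<alpha> \<nu> b M X" and n: "1 \<le> n"
  shows "Limsup thresholds_at_top (\<lambda>u. emeasure (\<mu> u) (joint_set K n)) \<le> emeasure \<nu> (joint_set K n)"
  unfolding limsup_joint_iff[OF n]
proof (intro allI impI)
  fix e :: real assume e: "0 < e"
  let ?W = "{f. 1 / real n < joint_level K n f}"
  have op: "open ?W"
    by (intro open_superlevel continuous_joint n)
  have "conv_on ?W"
  proof (rule conv_on_superlevel[OF continuous_joint[OF n]])
    fix g :: "('t, 'q) cfun \<Rightarrow> real" and c :: real
    assume "0 < c" "bdd_continuous g" and *: "\<And>f. \<not> c < joint_level K n f \<Longrightarrow> g f = 0"
    then show "conv g"
      using n by (intro conv_windowed[OF RV, of g "\<lambda>_. n" c])
        (auto simp: joint_level_def less_Min_UNIV_iff intro!: *)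
  next
    show "emeasure \<nu> {f. c < joint_level K n f} < \<infinity>" if "0 < c" for c
      using n that by (rule nu_finite_joint)
    show "isCont (\<lambda>c. measure \<nu> {f. c < joint_level K n f}) (1 / real n)"
      using n by (rule isCont_joint) (use n in auto)
  qed (use n in auto)
  moreover have "bdd_continuous (\<lambda>_ :: ('t, 'q) cfun. 1)"
    by (simp add: bdd_continuous_def)
  ultimately have "conv (\<lambda>f. 1 * indicator ?W f)"
    unfolding conv_on_def by blast
  then have "((\<lambda>u. measure (\<mu> u) ?W) \<longlongrightarrow> measure \<nu> ?W) thresholds_at_top"
    by (simp add: conv_def open_in_sets[OF op])
  then show "\<forall>\<^sub>F u in thresholds_at_top. measure (\<mu> u) ?W < measure \<nu> ?W + e"
    using e by (intro order_tendstoD(2)) auto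
qed

lemma RV_Pi_of_anchor_convergence:
  assumes D: "countable D"
    and dense: "\<And>n (f :: ('t, 'q) cfun) i c. 1 \<le> n \<Longrightarrow> c < rho K n i f \<Longrightarrow> \<exists>t\<in>D \<inter> K n. c < \<bar>apply_cfun f t $ i\<bar>"
    and anchors: "anchor_convergence D \<mu> \<nu>"
    and upper: "\<And>n. 1 \<le> n \<Longrightarrow>
      Limsup thresholds_at_top (\<lambda>u. emeasure (\<mu> u) (joint_set K n)) \<le> emeasure \<nu> (joint_set K n)"
  shows "RV_Pi K \<alpha> \<nu> b M X"
  unfolding RV_Pi_def
proof (intro conjI ballI allI)
  show "regularly_varying (b i) (\<alpha> $ i)" for i
    by (rule b)
  show "emeasure \<nu> (space \<nu>) \<noteq> 0"
    by (rule nu_nonzero[OF \<alpha> prob_N Z_measurable])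
  \<comment> \<open>The largest index and the smallest threshold turn a product window into part of
    one joint superlevel set. Its level \<open>c\<close> is in general not
    \<open>1 / real n0\<close>, so both conditions have to be rescaled below.\<close>
  have window_sub: "\<exists>c>0. \<exists>n0\<ge>1. window K n \<epsilon> \<subseteq> {f. c < joint_level K n0 f}"
    if n: "\<And>i. 1 \<le> n i" and \<epsilon>: "\<epsilon> \<in> pos_orthant" for n :: "'q \<Rightarrow> nat" and \<epsilon> :: "real ^ 'q"
  proof (intro exI conjI)
    let ?c = "MIN i. \<epsilon> $ i" and ?n = "MAX i. n i"
    show "0 < ?c"
      using \<epsilon> by (simp add: less_Min_UNIV_iff pos_orthant_nth)
    have le: "n i \<le> ?n" for i
      by (intro Max_ge) auto
    show "1 \<le> ?n"
      using n[of undefined] le[of undefined] by linarith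
    have c: "?c \<le> \<epsilon> $ i" for i
      by (intro Min_le) auto
    show "window K n \<epsilon> \<subseteq> {f. ?c < joint_level K ?n f}"
      unfolding joint_superlevel_eq
    proof (intro subsetI CollectI allI)
      fix f :: "('t, 'q) cfun" and i assume "f \<in> window K n \<epsilon>"
      then have "\<epsilon> $ i < rho K (n i) i f"
        by (simp add: window_def)
      with c[of i] rho_mono[OF K n le, of i i f] show "?c < rho K ?n i f"
        by linarith
    qed
  qed
  show "boundedly_finite K \<nu>"
    unfolding boundedly_finite_def
  proof (intro allI impI)
    fix n :: "'q \<Rightarrow> nat" and \<epsilon> :: "real ^ 'q" assume "\<forall>i. 1 \<le> n i" "\<epsilon> \<in> pos_orthant"
    then obtain c n0 where *: "0 < c" "1 \<le> n0" "window K n \<epsilon> \<subseteq> {f. c < joint_level K n0 f}"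
      using window_sub[of n \<epsilon>] by auto
    have "emeasure \<nu> (window K n \<epsilon>) \<le> emeasure \<nu> {f. c < joint_level K n0 f}"
      using * by (intro emeasure_mono open_in_sets open_superlevel continuous_joint) auto
    also have "\<dots> < \<infinity>"
      using * by (intro nu_finite_joint)
    finally show "emeasure \<nu> (window K n \<epsilon>) < \<infinity>" .
  qed
  fix F :: "('t, 'q) cfun \<Rightarrow> real" assume "F \<in> test_functions K"
  then obtain n \<epsilon> where F: "bdd_continuous F" "\<forall>i. 1 \<le> n i" "\<epsilon> \<in> pos_orthant" "\<And>f. f \<notin> window K n \<epsilon> \<Longrightarrow> F f = 0"
    by (auto simp: test_functions_def bdd_continuous_def)
  then obtain c n0 where c: "0 < c" "1 \<le> n0" "window K n \<epsilon> \<subseteq> {f. c < joint_level K n0 f}"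
    using window_sub[of n \<epsilon>] by auto
  let ?W = "{f. c < joint_level K n0 f}" and ?H = "PiE (UNIV :: 'q set) (\<lambda>_. D \<inter> K n0)"
  have cover: "?W = (\<Union>h\<in>?H. {f. c < anchor_level h f})"
    using c dense by (intro joint_level_cover) auto
  \<comment> \<open>The case split is needed because \<open>from_nat_into\<close> enumerates only
    nonempty sets; without anchors the cover is empty and \<open>F\<close> vanishes
    identically.\<close>
  show "((\<lambda>u. \<integral>f. F f \<partial>\<mu> u) \<longlongrightarrow> (\<integral>f. F f \<partial>\<nu>)) thresholds_at_top"
  proof (cases "?H = {}")
    case True
    then have "F f = 0" for f
      using F(4) c(3) cover by auto
    then show ?thesis
      by simp
  next
    case False
    have "countable ?H"
      using D by (intro countable_PiE) auto
    then have H: "range (from_nat_into ?H) = ?H"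
      using False by (intro range_from_nat_into)
    have "conv F"
    proof (rule conv_of_anchors[where W = ?W and q = "\<lambda>j. anchor_level (from_nat_into ?H j)" and c = c])
      show "?W = (\<Union>j. {f. c < anchor_level (from_nat_into ?H j) f})"
        unfolding cover by (subst H[symmetric]) simp
      show "conv_on {f. c < anchor_level (from_nat_into ?H j) f}" for j
      proof (rule conv_on_rescale[OF continuous_on_anchor_level anchor_level_scale _ c(1)])
        have "from_nat_into ?H j \<in> ?H"
          using False by (rule from_nat_into)
        then show "conv_on {f. 1 < anchor_level (from_nat_into ?H j) f}"
          using anchors by (auto simp: anchor_convergence_iff PiE_iff)
      qed auto
      show "\<forall>\<^sub>F u in thresholds_at_top. measure (\<mu> u) ?W < measure \<nu> ?W + e" if "0 < e" for e
      proof (rule limsup_joint_rescale[OF c(2) _ c(1) that])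
        show "0 < 1 / real n0"
          using c(2) by simp
        show "\<forall>\<^sub>F u in thresholds_at_top. measure (\<mu> u) {f. 1 / real n0 < joint_level K n0 f}
            < measure \<nu> {f. 1 / real n0 < joint_level K n0 f} + e" if "0 < e" for e
          using upper[OF c(2)] that unfolding limsup_joint_iff[OF c(2)] by blast
      qed
      show "continuous_on UNIV (anchor_level (from_nat_into ?H j))" for j
        by (rule continuous_on_anchor_level)
      show "emeasure \<nu> ?W < \<infinity>"
        using c by (intro nu_finite_joint)
      show "F f = 0" if "f \<notin> ?W" for f
        using c(3) that by (intro F(4)) blast
    qed (rule F(1))
    then show ?thesis
      by (simp add: conv_def)
  qed
qed

text \<open>Over a finite \<open>K n\<close> the suprema are attained at finitely many anchors, so
  finitely many anchored sets cover the joint set at every positive level and no mass can slip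
  between them.\<close>

lemma limsup_joint_of_finite:
  assumes n: "1 \<le> n" and fin: "finite (K n)" and anchors: "anchor_convergence UNIV \<mu> \<nu>"
  shows "Limsup thresholds_at_top (\<lambda>u. emeasure (\<mu> u) (joint_set K n)) \<le> emeasure \<nu> (joint_set K n)"
  unfolding limsup_joint_iff[OF n]
proof (intro allI impI)
  fix e :: real assume e: "0 < e"
  show "\<forall>\<^sub>F u in thresholds_at_top. measure (\<mu> u) {f. 1 / real n < joint_level K n f}
        < measure \<nu> {f. 1 / real n < joint_level K n f} + e"
  proof (rule finite_cover_limsup[where J = "PiE UNIV (\<lambda>_. UNIV \<inter> K n)" and q = anchor_level])
    show "finite (PiE (UNIV :: 'q set) (\<lambda>_. UNIV \<inter> K n))"
      using fin by (intro finite_PiE) auto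
    show "{f :: ('t, 'q) cfun. c < joint_level K n f} =
        (\<Union>h\<in>PiE UNIV (\<lambda>_. UNIV \<inter> K n). {f. c < anchor_level h f})" for c
      using n exhaustion_compact[OF K n] by (intro joint_level_cover) (auto simp: less_rho_iff)
    show "conv_on {f. c < anchor_level h f}" if "0 < c" for c h
    proof (rule conv_on_rescale[OF continuous_on_anchor_level anchor_level_scale _ that])
      show "conv_on {f. 1 < anchor_level h f}"
        using anchors by (simp add: anchor_convergence_iff)
    qed
    show "emeasure \<nu> {f. c < joint_level K n f} < \<infinity>" if "0 < c" for c
      using n that by (rule nu_finite_joint)
    show "isCont (\<lambda>c. measure \<nu> {f. c < joint_level K n f}) (1 / real n)"
      using n by (rule isCont_joint) (use n in auto)
    show "continuous_on UNIV (anchor_level h)" for h :: "'q \<Rightarrow> 't"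
      by (rule continuous_on_anchor_level)
    show "continuous_on UNIV (joint_level K n)"
      using n by (rule continuous_joint)
  qed (use n e in auto)
qed

end

text \<open>Index sets are modelled as types, hence the two conjuncts: a countable type with
  discrete topology, where all points serve as anchors, and Euclidean space with its cubes and
  rational anchors.\<close>

theorem theorem3p4:
  fixes \<alpha> :: "real ^ 'q::finite"
    and b :: "'q \<Rightarrow> real \<Rightarrow> real"
    and M :: "'w measure" and N :: "'v measure"
  assumes "\<alpha> \<in> pos_orthant"
    and "\<forall>i. regularly_varying (b i) (\<alpha> $ i)"
    and "prob_space M" and "prob_space N"
  shows
    "(\<forall>(K :: nat \<Rightarrow> 'd::{countable, discrete_topology} set)
       (X :: 'w \<Rightarrow> ('d, 'q) cfun) (Z :: 'v \<Rightarrow> ('d, 'q) cfun).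
        exhaustion K \<longrightarrow> X \<in> borel_measurable M \<longrightarrow> representer K \<alpha> N Z \<longrightarrow>
        (RV_Pi K \<alpha> (nu \<alpha> N Z) b M X \<longleftrightarrow> anchor_convergence UNIV (mu b M X) (nu \<alpha> N Z)) \<and>
        (anchor_convergence UNIV (mu b M X) (nu \<alpha> N Z) \<longrightarrow>
          (\<forall>n\<ge>1. Limsup thresholds_at_top (\<lambda>u. emeasure (mu b M X u) (joint_set K n))
                    \<le> emeasure (nu \<alpha> N Z) (joint_set K n)))) \<and>
     (\<forall>(X :: 'w \<Rightarrow> (real ^ 'm::finite, 'q) cfun) (Z :: 'v \<Rightarrow> (real ^ 'm, 'q) cfun).
        X \<in> borel_measurable M \<longrightarrow> representer cube \<alpha> N Z \<longrightarrow>
        (RV_Pi cube \<alpha> (nu \<alpha> N Z) b M X \<longleftrightarrow>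
          anchor_convergence rat_points (mu b M X) (nu \<alpha> N Z) \<and>
          (\<forall>n\<ge>1. Limsup thresholds_at_top (\<lambda>u. emeasure (mu b M X u) (joint_set cube n))
                    \<le> emeasure (nu \<alpha> N Z) (joint_set cube n))))"
proof (intro conjI allI impI)
  have b: "regularly_varying (b i) (\<alpha> $ i)" for i
    using assms(2) by blast
  fix K :: "nat \<Rightarrow> 'd set" and X :: "'w \<Rightarrow> ('d, 'q) cfun" and Z :: "'v \<Rightarrow> ('d, 'q) cfun"
  assume K: "exhaustion K" and X: "X \<in> borel_measurable M" and Z: "representer K \<alpha> N Z"
  interpret field_representer \<alpha> b M N K X Z
    by (rule field_representer.intro[OF assms(1) b assms(3,4) K X Z])
  have fin: "finite (K n)" if "1 \<le> n" for n
    using exhaustion_compact[OF K that] by (intro finite_compact_discrete) auto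
  have dense: "\<exists>t\<in>UNIV \<inter> K n. c < \<bar>apply_cfun f t $ i\<bar>" if "1 \<le> n" "c < rho K n i f" for n f i c
    using that exhaustion_compact[OF K] by (auto simp: less_rho_iff)
  \<comment> \<open>Compact sets of a discrete space are finite, so the anchored condition already
    yields the upper bound. It is then fed into the same converse implication as in the Euclidean
    case.\<close>
  have limsup: "Limsup thresholds_at_top (\<lambda>u. emeasure (mu b M X u) (joint_set K n))
      \<le> emeasure (nu \<alpha> N Z) (joint_set K n)"
    if "anchor_convergence UNIV (mu b M X) (nu \<alpha> N Z)" "1 \<le> n" for n
    using that by (intro limsup_joint_of_finite fin)
  then show "Limsup thresholds_at_top (\<lambda>u. emeasure (mu b M X u) (joint_set K n))
      \<le> emeasure (nu \<alpha> N Z) (joint_set K n)"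
    if "anchor_convergence UNIV (mu b M X) (nu \<alpha> N Z)" "1 \<le> n" for n
    using that by blast
  show "RV_Pi K \<alpha> (nu \<alpha> N Z) b M X \<longleftrightarrow> anchor_convergence UNIV (mu b M X) (nu \<alpha> N Z)"
  proof
    assume "anchor_convergence UNIV (mu b M X) (nu \<alpha> N Z)"
    then show "RV_Pi K \<alpha> (nu \<alpha> N Z) b M X"
      by (intro RV_Pi_of_anchor_convergence[of UNIV] dense limsup) auto
  qed (rule anchor_convergence_of_RV_Pi)
next
  have b: "regularly_varying (b i) (\<alpha> $ i)" for i
    using assms(2) by blast
  fix X :: "'w \<Rightarrow> (real ^ 'm, 'q) cfun" and Z :: "'v \<Rightarrow> (real ^ 'm, 'q) cfun"
  assume X: "X \<in> borel_measurable M" and Z: "representer cube \<alpha> N Z"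
  interpret field_representer \<alpha> b M N cube X Z
    by (rule field_representer.intro[OF assms(1) b assms(3,4) exhaustion_cube X Z])
  show "RV_Pi cube \<alpha> (nu \<alpha> N Z) b M X \<longleftrightarrow>
      anchor_convergence rat_points (mu b M X) (nu \<alpha> N Z) \<and>
      (\<forall>n\<ge>1. Limsup thresholds_at_top (\<lambda>u. emeasure (mu b M X u) (joint_set cube n))
                \<le> emeasure (nu \<alpha> N Z) (joint_set cube n))"
  proof (intro iffI conjI allI impI)
    assume "anchor_convergence rat_points (mu b M X) (nu \<alpha> N Z) \<and>
      (\<forall>n\<ge>1. Limsup thresholds_at_top (\<lambda>u. emeasure (mu b M X u) (joint_set cube n))
                \<le> emeasure (nu \<alpha> N Z) (joint_set cube n))"
    then show "RV_Pi cube \<alpha> (nu \<alpha> N Z) b M X"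
      by (intro RV_Pi_of_anchor_convergence[OF countable_rat_points rat_points_dense_rho]) auto
  qed (rule anchor_convergence_of_RV_Pi limsup_joint_of_RV_Pi; assumption)+
qed

end
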